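(* Let $n\in\mathbb{N}$, let $g\in C_0^\infty(M)$ be real-valued, and let $V_g(\phi)=\int_M g(x)\phi(x)^n\,dx$. Then $$S(V_g)\star_\lambda S(V_g)^*=1=S(V_g)^*\star_\lambda S(V_g)$$ to all orders in perturbation theory.
   Context: Fix $m,\lambda>0$. $M=\mathbb{R}^4$, points $x=(x^0,\mathbf{x})$; $\omega(\mathbf{p})=\sqrt{|\mathbf{p}|^2+m^2}$ for $\mathbf{p}\in\mathbb{R}^3$. Propagators: $$\Delta_{+,\lambda}(x)=\frac{1}{(2\pi)^3}\int_{\mathbb{R}^3}\frac{d\mathbf{p}}{2\omega(\mathbf{p})}e^{-\lambda^2(2|\mathbf{p}|^2+m^2)}e^{-i(\omega(\mathbf{p})x^0-\mathbf{p}\cdot\mathbf{x})},\quad \Delta_{F,\lambda}(x)=\theta(x^0)\Delta_{+,\lambda}(x)+\theta(-x^0)\Delta_{+,\lambda}(-x).$$ Field configurations: $\mathcal{C}=C^\infty(M;\mathbb{R})\cap\mathcal{S}'(M)$. $\mathcal{A}$ is the space of functionals $A:\mathcal{C}\to\mathbb{C}$ that are finite sums of functionals of the form $\phi\mapsto\int_{M^\ell}dx_1\cdots dx_\ell\,f(x_1,\dots,x_\ell)\,\phi(x_1)^{n_1}\cdots\phi(x_\ell)^{n_\ell}$ with $\ell\ge1$, $n_i\in\mathbb{N}_0$, and $f$ continuous with compact support in $M^\ell$. Involution: $A^*(\phi)=\overline{A(\phi)}$. For a function $D$ on $M$ let $\Gamma_D=\int_{M^2}dx\,dy\,D(x-y)\frac{\delta}{\delta\phi(x)}\otimes\frac{\delta}{\delta\phi(y)}$,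 and let $m(A\otimes B)(\phi)=A(\phi)B(\phi)$. Products on $\mathcal{A}$: $A\star_\lambda B=m\circ e^{\Gamma_{\Delta_{+,\lambda}}}(A\otimes B)$ and the commutative product $A\cdot_{T_\lambda}B=m\circ e^{\Gamma_{\Delta_{F,\lambda}}}(A\otimes B)$. For $A\in\mathcal{A}$, $S(A)=\sum_{k\ge0}\kappa^k\frac{(-i)^k}{k!}A^{\cdot_{T_\lambda}k}\in\mathcal{A}[[\kappa]]$, with $\kappa$ a formal (real, $\kappa^*=\kappa$) parameter counting the perturbative order and $A^{\cdot_{T_\lambda}k}$ the $k$-fold $\cdot_{T_\lambda}$-power. The identities are in $\mathcal{A}[[\kappa]]$, with $\star_\lambda$ and $*$ extended coefficientwise. *)

theory Defs
  imports "HOL-Analysis.Analysis"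
begin

text \<open>Points of Minkowski space \<open>M\<close> are written \<open>x = (x\<^sup>0, \<^bold>x)\<close>. As a measure space
  and as a normed space \<open>real \<times> real^3\<close> is \<open>\<real>\<^sup>4\<close>.\<close>

type_synonym spacetime = "real \<times> (real ^ 3)"


section \<open>Smooth functions, tempered distributions, field configurations\<close>

definition dir_deriv ::
  "'a::real_normed_vector \<Rightarrow> ('a \<Rightarrow> 'b::real_normed_vector) \<Rightarrow> 'a \<Rightarrow> 'b" where
  "dir_deriv v f x = frechet_derivative f (at x) v"

text \<open>\<open>iter_deriv [b\<^sub>1, \<dots>, b\<^sub>k] f = \<partial>\<^bsub>b\<^sub>1\<^esub> \<dots> \<partial>\<^bsub>b\<^sub>k\<^esub> f\<close>; lists of basis vectors play the role of
  multi-indices.\<close>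

definition iter_deriv ::
  "'a::real_normed_vector list \<Rightarrow> ('a \<Rightarrow> 'b::real_normed_vector) \<Rightarrow> 'a \<Rightarrow> 'b" where
  "iter_deriv vs f = foldr dir_deriv vs f"

definition smooth :: "('a::euclidean_space \<Rightarrow> 'b::real_normed_vector) \<Rightarrow> bool" where
  "smooth f \<longleftrightarrow> (\<forall>vs. set vs \<subseteq> Basis \<longrightarrow> iter_deriv vs f differentiable_on UNIV)"

definition test_functions :: "(spacetime \<Rightarrow> 'b::real_normed_vector) set" where
  "test_functions = {f. smooth f \<and> compact (closure {x. f x \<noteq> 0})}"

definition schwartz_functions :: "(spacetime \<Rightarrow> complex) set" where
  "schwartz_functions =
     {f. smooth f \<and>
         (\<forall>N vs. set vs \<subseteq> Basis \<longrightarrow> bounded (range (\<lambda>x. (1 + norm x) ^ N *\<^sub>R iter_deriv vs f x)))}"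

definition schwartz_norm :: "nat \<Rightarrow> (spacetime \<Rightarrow> complex) \<Rightarrow> real" where
  "schwartz_norm N f =
     (SUP (vs, x) \<in> {vs. set vs \<subseteq> Basis \<and> length vs \<le> N} \<times> UNIV.
        (1 + norm x) ^ N * norm (iter_deriv vs f x))"

definition tempered_distributions :: "((spacetime \<Rightarrow> complex) \<Rightarrow> complex) set" where
  "tempered_distributions =
     {T. (\<forall>f\<in>schwartz_functions. \<forall>h\<in>schwartz_functions. T (\<lambda>x. f x + h x) = T f + T h) \<and>
         (\<forall>c. \<forall>f\<in>schwartz_functions. T (\<lambda>x. c * f x) = c * T f) \<and>
         (\<exists>N C. \<forall>f\<in>schwartz_functions. norm (T f) \<le> C * schwartz_norm N f)}"

text \<open>\<open>\<C> = C\<^sup>\<infinity>(M; \<real>) \<inter> \<S>'(M)\<close>: the intersection is taken inside the space of all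
  distributions, where a function \<open>\<phi>\<close> is identified with \<open>f \<mapsto> \<integral> \<phi> f\<close>. It therefore contains
  functions that are not polynomially bounded.\<close>

definition configs :: "(spacetime \<Rightarrow> real) set" where
  "configs =
     {\<phi>. smooth \<phi> \<and>
         (\<exists>T\<in>tempered_distributions. \<forall>f\<in>test_functions.
            T f = (LINT x|lborel. complex_of_real (\<phi> x) * f x))}"


section \<open>Propagators\<close>

definition omega :: "real \<Rightarrow> real ^ 3 \<Rightarrow> real" where
  "omega m p = sqrt ((norm p)\<^sup>2 + m\<^sup>2)"

definition Delta_plus :: "real \<Rightarrow> real \<Rightarrow> spacetime \<Rightarrow> complex" where
  "Delta_plus m lam x =
     1 / (2 * of_real pi) ^ 3 *
     (LINT p|lborel.
        of_real (1 / (2 * omega m p)) *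
        of_real (exp (- (lam\<^sup>2 * (2 * (norm p)\<^sup>2 + m\<^sup>2)))) *
        exp (- \<i> * of_real (omega m p * fst x - p \<bullet> snd x)))"

text \<open>The value \<open>\<theta>(0) = 1/2\<close> makes \<open>\<Delta>\<^sub>F\<close> continuous across \<open>x\<^sup>0 = 0\<close>, where
  \<open>\<Delta>\<^sub>+(x) = \<Delta>\<^sub>+(-x)\<close>.\<close>

definition heaviside :: "real \<Rightarrow> real" where
  "heaviside t = (if t > 0 then 1 else if t = 0 then 1 / 2 else 0)"

definition Delta_F :: "real \<Rightarrow> real \<Rightarrow> spacetime \<Rightarrow> complex" where
  "Delta_F m lam x =
     of_real (heaviside (fst x)) * Delta_plus m lam x +
     of_real (heaviside (- fst x)) * Delta_plus m lam (- x)"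


section \<open>Functionals\<close>

text \<open>Only the values of a functional on \<^const>\<open>configs\<close> are meaningful; functionals are
  compared there.\<close>

type_synonym functional = "(spacetime \<Rightarrow> real) \<Rightarrow> complex"

text \<open>\<open>M\<^sup>l\<close> is the space of extensional functions \<open>{..<l} \<rightarrow>\<^sub>E UNIV\<close>, with the product topology
  and the product measure.\<close>

definition cc_kernel :: "nat \<Rightarrow> ((nat \<Rightarrow> spacetime) \<Rightarrow> complex) \<Rightarrow> bool" where
  "cc_kernel l f \<longleftrightarrow>
     continuous_on ({..<l} \<rightarrow>\<^sub>E UNIV) f \<and>
     (\<exists>K. compact K \<and> (\<forall>x \<in> {..<l} \<rightarrow>\<^sub>E UNIV. f x \<noteq> 0 \<longrightarrow> (\<forall>i<l. x i \<in> K)))"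

definition monomial_functional ::
  "nat \<Rightarrow> (nat \<Rightarrow> nat) \<Rightarrow> ((nat \<Rightarrow> spacetime) \<Rightarrow> complex) \<Rightarrow> functional" where
  "monomial_functional l ns f \<phi> =
     (LINT x|Pi\<^sub>M {..<l} (\<lambda>_. lborel). f x * (\<Prod>i<l. complex_of_real (\<phi> (x i)) ^ ns i))"

definition functionals :: "functional set" where
  "functionals =
     {A. \<exists>(N::nat) l ns f.
        (\<forall>j<N. l j \<ge> 1 \<and> cc_kernel (l j) (f j)) \<and>
        (\<forall>\<phi>\<in>configs. A \<phi> = (\<Sum>j<N. monomial_functional (l j) (ns j) (f j) \<phi>))}"

definition adj :: "functional \<Rightarrow> functional" where
  "adj A \<phi> = cnj (A \<phi>)"

definition interaction :: "(spacetime \<Rightarrow> real) \<Rightarrow> nat \<Rightarrow> functional" where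
  "interaction g n \<phi> = of_real (LINT x|lborel. g x * \<phi> x ^ n)"


section \<open>The operator \<open>\<Gamma>\<^sub>D\<close> and the products\<close>

text \<open>Elements of \<open>\<A> \<otimes> \<A>\<close> are functionals of two configurations, with
  \<open>(A \<otimes> B)(\<phi>, \<psi>) = A(\<phi>) B(\<psi>)\<close>.\<close>

type_synonym functional2 = "(spacetime \<Rightarrow> real) \<Rightarrow> (spacetime \<Rightarrow> real) \<Rightarrow> complex"

definition tensor :: "functional \<Rightarrow> functional \<Rightarrow> functional2" where
  "tensor A B \<phi> \<psi> = A \<phi> * B \<psi>"

definition diag :: "functional2 \<Rightarrow> functional" where
  "diag F \<phi> = F \<phi> \<phi>"

text \<open>Compactly supported complex Radon measures on \<open>M\<^sup>2\<close>, as continuous linear forms on the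
  space of continuous functions (topology of uniform convergence on compact sets).\<close>

definition radon2 :: "((spacetime \<times> spacetime \<Rightarrow> complex) \<Rightarrow> complex) \<Rightarrow> bool" where
  "radon2 T \<longleftrightarrow>
     (\<forall>u v. continuous_on UNIV u \<longrightarrow> continuous_on UNIV v \<longrightarrow> T (\<lambda>z. u z + v z) = T u + T v) \<and>
     (\<forall>c u. continuous_on UNIV u \<longrightarrow> T (\<lambda>z. c * u z) = c * T u) \<and>
     (\<exists>K C. compact K \<and>
        (\<forall>u B. continuous_on UNIV u \<longrightarrow> (\<forall>z\<in>K. norm (u z) \<le> B) \<longrightarrow> norm (T u) \<le> C * B))"

text \<open>\<open>T\<close> is the second functional derivative \<open>\<delta>\<^sup>2F / \<delta>\<phi>(x) \<delta>\<psi>(y)\<close> at \<open>(\<phi>, \<psi>)\<close>: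
  \<open>T(h \<otimes> k) = \<partial>\<^sub>s \<partial>\<^sub>t F(\<phi> + s h, \<psi> + t k)\<close> at \<open>s = t = 0\<close>. On the functionals that occur, this
  distribution is of order 0, so that it can be paired with \<open>D(x - y)\<close> for continuous
  \<open>D\<close> that are not smooth, such as \<open>\<Delta>\<^sub>F\<close>. The linear span of the functions \<open>h \<otimes> k\<close> is
  dense in the continuous functions, so \<open>T\<close> is unique on them.\<close>

definition mixed_deriv ::
  "functional2 \<Rightarrow> (spacetime \<Rightarrow> real) \<Rightarrow> (spacetime \<Rightarrow> real) \<Rightarrow>
     ((spacetime \<times> spacetime \<Rightarrow> complex) \<Rightarrow> complex) \<Rightarrow> bool" where
  "mixed_deriv F \<phi> \<psi> T \<longleftrightarrow>
     radon2 T \<and>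
     (\<forall>h\<in>configs. \<forall>k\<in>configs. \<exists>d.
        (\<forall>s. ((\<lambda>t. F (\<lambda>x. \<phi> x + s * h x) (\<lambda>y. \<psi> y + t * k y)) has_vector_derivative d s) (at 0)) \<and>
        (d has_vector_derivative T (\<lambda>(x, y). complex_of_real (h x * k y))) (at 0))"

definition Gamma :: "(spacetime \<Rightarrow> complex) \<Rightarrow> functional2 \<Rightarrow> functional2" where
  "Gamma D F \<phi> \<psi> = (SOME T. mixed_deriv F \<phi> \<psi> T) (\<lambda>(x, y). D (x - y))"

text \<open>On \<open>\<A> \<otimes> \<A>\<close> the exponential series has only finitely many nonzero terms.\<close>

definition exp_Gamma :: "(spacetime \<Rightarrow> complex) \<Rightarrow> functional2 \<Rightarrow> functional2" where
  "exp_Gamma D F \<phi> \<psi> = (\<Sum>k. (Gamma D ^^ k) F \<phi> \<psi> / fact k)"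

definition star :: "real \<Rightarrow> real \<Rightarrow> functional \<Rightarrow> functional \<Rightarrow> functional" where
  "star m lam A B = diag (exp_Gamma (Delta_plus m lam) (tensor A B))"

definition tprod :: "real \<Rightarrow> real \<Rightarrow> functional \<Rightarrow> functional \<Rightarrow> functional" where
  "tprod m lam A B = diag (exp_Gamma (Delta_F m lam) (tensor A B))"

primrec tpower :: "real \<Rightarrow> real \<Rightarrow> functional \<Rightarrow> nat \<Rightarrow> functional" where
  "tpower m lam A 0 = (\<lambda>\<phi>. 1)"
| "tpower m lam A (Suc k) = tprod m lam A (tpower m lam A k)"


section \<open>Formal power series of functionals\<close>

text \<open>An element \<open>\<Sum>\<^sub>k \<kappa>\<^sup>k X\<^sub>k\<close> of \<open>\<A>[[\<kappa>]]\<close> is its sequence of coefficients.\<close>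

type_synonym fseries = "nat \<Rightarrow> functional"

definition formal_functionals :: "fseries set" where
  "formal_functionals = {X. \<forall>k. X k \<in> functionals}"

definition series_star :: "real \<Rightarrow> real \<Rightarrow> fseries \<Rightarrow> fseries \<Rightarrow> fseries" where
  "series_star m lam X Y k \<phi> = (\<Sum>j\<le>k. star m lam (X j) (Y (k - j)) \<phi>)"

definition series_adj :: "fseries \<Rightarrow> fseries" where
  "series_adj X k = adj (X k)"

definition series_one :: fseries where
  "series_one k = (\<lambda>\<phi>. if k = 0 then 1 else 0)"

definition S_matrix :: "real \<Rightarrow> real \<Rightarrow> functional \<Rightarrow> fseries" where
  "S_matrix m lam A k \<phi> = (- \<i>) ^ k / fact k * tpower m lam A k \<phi>"

text \<open>Equality in \<open>\<A>[[\<kappa>]]\<close>.\<close>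

definition series_eq :: "fseries \<Rightarrow> fseries \<Rightarrow> bool" where
  "series_eq X Y \<longleftrightarrow>
     X \<in> formal_functionals \<and> Y \<in> formal_functionals \<and> (\<forall>k. \<forall>\<phi>\<in>configs. X k \<phi> = Y k \<phi>)"

end

theory Submission
  imports Defs "HOL-Probability.Sinc_Integral" "HOL-Real_Asymp.Real_Asymp"
begin

text \<open>By Wick's theorem each term of order \<open>k\<close> in the product is an integral over \<open>k\<close> vertices, split
  into a set \<open>X\<close> belonging to the left factor and its complement, where a pair of vertices is contracted
  with \<open>\<Delta>\<^sub>F\<close>, its conjugate, or \<open>\<Delta>\<^sub>+\<close> according to the factors in which the two vertices lie. Let
  \<open>z\<close> be the earliest vertex. Since \<open>\<Delta>\<^sub>F(u)\<close> is \<open>\<Delta>\<^sub>+(u)\<close> for \<open>u\<^sup>0 \<ge> 0\<close> and \<open>\<Delta>\<^sub>+(-u)\<close> for \<open>u\<^sup>0 \<le> 0\<close>, and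
  since \<open>\<Delta>\<^sub>+(-u)\<close> is the conjugate of \<open>\<Delta>\<^sub>+(u)\<close>, all contractions stay the same when \<open>z\<close> is moved from
  one factor to the other in \<open>S \<star> S\<^sup>*\<close>, while the sign \<open>(-1)\<^bsup>card X\<^esup>\<close> changes. For \<open>S\<^sup>* \<star> S\<close> one moves
  the latest vertex. All terms of positive order therefore cancel pairwise.

  The operator \<open>\<Gamma>\<^sub>D\<close> is computed from an explicit second derivative, which is unique because
  polynomials are field configurations and are dense by the Stone-Weierstrass theorem.\<close>


section \<open>Polynomials are field configurations\<close>

text \<open>\<open>Gamma\<close> is a choice operator followed by evaluation at
  \<open>D (x - y)\<close>. Its value can be computed only once all admissible choices are known to
  agree on every continuous function, while its specification tests them only on products
  \<open>h x * k y\<close>. Iteration raises a second obstacle: each result must again have a form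
  that can be differentiated. The form preserved here is a single integral, over the vertices of
  both factors together, of a polynomial in the field values. Sorted by the number r of lines
  joining the two factors, \<open>Gamma\<close> takes order r to r + 1 times order r + 1, and the
  exponential series divides the accumulated factorial out again.\<close>

lemma integrable_one_plus_norm_power:
  "integrable lborel (\<lambda>x::'a::euclidean_space. 1 / (1 + norm x) ^ (2 * DIM('a)))"
proof (rule integrableI_bounded)
  show "(\<lambda>x::'a. 1 / (1 + norm x) ^ (2 * DIM('a))) \<in> borel_measurable lborel" by simp
  define h where "h t = inverse (1 + t\<^sup>2)" for t :: real
  have h0: "h t \<ge> 0" for t by (simp add: h_def)
  have hm [measurable]: "h \<in> borel_measurable borel" by (simp add: h_def[abs_def])
  have "integrable lborel h"
    using integrable_inverse_1_plus_square by (simp add: set_integrable_def h_def[abs_def])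
  then have fin: "(\<integral>\<^sup>+t. h t \<partial>lborel) < \<infinity>"
    using h0 by (simp add: integrable_iff_bounded)
  \<comment> \<open>The exponent provides one factor (1 + |x|)^(-2) per coordinate, and each is at
    most 1 / (1 + t^2) in that coordinate t. Tonelli then reduces the claim to the line.\<close>
  have bound: "1 / (1 + norm x) ^ (2 * DIM('a)) \<le> (\<Prod>b\<in>Basis. h (x \<bullet> b))" for x :: 'a
  proof -
    have "inverse ((1 + norm x)\<^sup>2) \<le> h (x \<bullet> b)" if "b \<in> Basis" for b
    proof -
      have "(x \<bullet> b)\<^sup>2 \<le> (norm x)\<^sup>2"
        using Basis_le_norm[OF that, of x] by (simp add: abs_le_square_iff[symmetric])
      then have "1 + (x \<bullet> b)\<^sup>2 \<le> (1 + norm x)\<^sup>2"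
        using norm_ge_zero[of x] by (simp add: power2_sum add_increasing2)
      then show ?thesis unfolding h_def by (intro le_imp_inverse_le) (auto simp: add_pos_nonneg)
    qed
    then have "(\<Prod>b\<in>(Basis::'a set). inverse ((1 + norm x)\<^sup>2)) \<le> (\<Prod>b\<in>Basis. h (x \<bullet> b))"
      by (intro prod_mono) auto
    then show ?thesis by (simp add: power_mult power_inverse divide_inverse)
  qed
  have "(\<integral>\<^sup>+x. ennreal (norm (1 / (1 + norm x) ^ (2 * DIM('a)))) \<partial>(lborel::'a measure))
      \<le> (\<integral>\<^sup>+x. (\<Prod>b\<in>Basis. ennreal (h (x \<bullet> b))) \<partial>(lborel::'a measure))"
    by (intro nn_integral_mono) (use bound h0 in \<open>auto simp: prod_ennreal intro!: ennreal_leI\<close>)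
  also have "\<dots> = (\<Prod>b\<in>(Basis::'a set). \<integral>\<^sup>+t. h t \<partial>lborel)"
    by (rule nn_integral_lborel_prod) auto
  also have "\<dots> < \<infinity>"
    using fin by (simp add: power_less_top_ennreal)
  finally show "(\<integral>\<^sup>+x. ennreal (norm (1 / (1 + norm x) ^ (2 * DIM('a)))) \<partial>(lborel::'a measure)) < \<infinity>" .
qed

lemma real_polynomial_function_has_derivative:
  fixes p :: "'a::real_normed_vector \<Rightarrow> real"
  assumes "real_polynomial_function p"
  obtains p' where "\<And>x. (p has_derivative (\<lambda>v. p' v x)) (at x)" "\<And>v. real_polynomial_function (p' v)"
  using assms
proof (induction arbitrary: thesis)
  case (linear f)
  show ?case
    by (rule linear(2)[of "\<lambda>v x. f v"]) (use linear(1) bounded_linear_imp_has_derivative in auto)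
next
  case (const c)
  show ?case by (rule const[of "\<lambda>v x. 0"]) auto
next
  case (add f g)
  from add(3) obtain f' where f: "\<And>x. (f has_derivative (\<lambda>v. f' v x)) (at x)" "\<And>v. real_polynomial_function (f' v)" by blast
  from add(4) obtain g' where g: "\<And>x. (g has_derivative (\<lambda>v. g' v x)) (at x)" "\<And>v. real_polynomial_function (g' v)" by blast
  show ?case
    by (rule add(5)[of "\<lambda>v x. f' v x + g' v x"]) (auto intro!: has_derivative_add f g)
next
  case (mult f g)
  from mult(3) obtain f' where f: "\<And>x. (f has_derivative (\<lambda>v. f' v x)) (at x)" "\<And>v. real_polynomial_function (f' v)" by blast
  from mult(4) obtain g' where g: "\<And>x. (g has_derivative (\<lambda>v. g' v x)) (at x)" "\<And>v. real_polynomial_function (g' v)" by blast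
  show ?case
    by (rule mult(5)[of "\<lambda>v x. f x * g' v x + f' v x * g x"])
       (intro has_derivative_mult f g mult(1,2) real_polynomial_function.intros(3,4))+
qed

lemma smooth_real_polynomial_function:
  fixes p :: "'a::euclidean_space \<Rightarrow> real"
  assumes "real_polynomial_function p"
  shows "smooth p"
proof -
  have "real_polynomial_function (iter_deriv vs p)" for vs
  proof (induction vs)
    case Nil
    then show ?case using assms by (simp add: iter_deriv_def)
  next
    case (Cons v vs)
    obtain q where q: "\<And>x. (iter_deriv vs p has_derivative (\<lambda>v. q v x)) (at x)"
      "\<And>v. real_polynomial_function (q v)"
      using real_polynomial_function_has_derivative[OF Cons] by blast
    have "iter_deriv (v # vs) p = q v"
      using frechet_derivative_at[OF q(1)] by (auto simp: iter_deriv_def dir_deriv_def fun_eq_iff)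
    then show ?case using q(2) by simp
  qed
  then show ?thesis
    unfolding smooth_def differentiable_on_def
    using differentiable_at_real_polynomial_function by blast
qed

lemma real_polynomial_function_growth:
  fixes p :: "'a::real_normed_vector \<Rightarrow> real"
  assumes "real_polynomial_function p"
  obtains C N where "C \<ge> 0" "\<And>x. \<bar>p x\<bar> \<le> C * (1 + norm x) ^ N"
  using assms
proof (induction arbitrary: thesis)
  case (linear f)
  obtain K where K: "\<And>x. norm (f x) \<le> norm x * K" "K > 0"
    using bounded_linear.pos_bounded[OF linear(1)] by blast
  show ?case
  proof (rule linear(2)[of K 1])
    show "\<bar>f x\<bar> \<le> K * (1 + norm x) ^ 1" for x
      using K(1)[of x] K(2) by (simp add: algebra_simps)
  qed (use K in auto)
next
  case (const c)
  show ?case by (rule const[of "\<bar>c\<bar>" 0]) auto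
next
  case (add f g)
  from add(3) obtain C N where f: "C \<ge> 0" "\<And>x. \<bar>f x\<bar> \<le> C * (1 + norm x) ^ N" by blast
  from add(4) obtain D M where g: "D \<ge> 0" "\<And>x. \<bar>g x\<bar> \<le> D * (1 + norm x) ^ M" by blast
  show ?case
  proof (rule add(5)[of "C + D" "max N M"])
    fix x :: 'a
    have "C * (1 + norm x) ^ N \<le> C * (1 + norm x) ^ max N M"
      "D * (1 + norm x) ^ M \<le> D * (1 + norm x) ^ max N M"
      using f g by (auto intro!: mult_left_mono power_increasing)
    then show "\<bar>f x + g x\<bar> \<le> (C + D) * (1 + norm x) ^ max N M"
      using f(2)[of x] g(2)[of x] by (simp add: algebra_simps)
  qed (use f g in auto)
next
  case (mult f g)
  from mult(3) obtain C N where f: "C \<ge> 0" "\<And>x. \<bar>f x\<bar> \<le> C * (1 + norm x) ^ N" by blast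
  from mult(4) obtain D M where g: "D \<ge> 0" "\<And>x. \<bar>g x\<bar> \<le> D * (1 + norm x) ^ M" by blast
  show ?case
  proof (rule mult(5)[of "C * D" "N + M"])
    fix x :: 'a
    have "\<bar>f x\<bar> * \<bar>g x\<bar> \<le> (C * (1 + norm x) ^ N) * (D * (1 + norm x) ^ M)"
      using f g by (intro mult_mono) auto
    then show "\<bar>f x * g x\<bar> \<le> (C * D) * (1 + norm x) ^ (N + M)"
      by (simp add: abs_mult power_add mult_ac)
  qed (use f g in auto)
qed

lemma smooth_imp_continuous: "smooth f \<Longrightarrow> continuous_on UNIV f"
  unfolding smooth_def iter_deriv_def
  using differentiable_imp_continuous_on by (force dest: spec[of _ "[]"])

text \<open>A supremum of reals bounds its members only if the set is bounded above. There are
  finitely many lists of basis vectors of length at most \<open>N\<close>, and each gives a bounded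
  weighted derivative.\<close>

lemma schwartz_norm_upper:
  assumes "f \<in> schwartz_functions"
  shows "(1 + norm x) ^ N * norm (f x) \<le> schwartz_norm N f"
proof -
  define I where "I = {vs. set vs \<subseteq> (Basis::spacetime set) \<and> length vs \<le> N}"
  have finI: "finite I" unfolding I_def by (rule finite_lists_length_le) simp
  have "\<exists>B. \<forall>y. (1 + norm y) ^ N * norm (iter_deriv vs f y) \<le> B" if "vs \<in> I" for vs
  proof -
    have "bounded (range (\<lambda>y. (1 + norm y) ^ N *\<^sub>R iter_deriv vs f y))"
      using assms that by (auto simp: schwartz_functions_def I_def)
    then show ?thesis
      by (auto simp: bounded_iff)
  qed
  then obtain B where B: "\<And>vs y. vs \<in> I \<Longrightarrow> (1 + norm y) ^ N * norm (iter_deriv vs f y) \<le> B vs"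
    by metis
  have "bdd_above ((\<lambda>(vs, y). (1 + norm y) ^ N * norm (iter_deriv vs f y)) ` (I \<times> UNIV))"
  proof (rule bdd_aboveI2)
    fix z assume z: "z \<in> I \<times> (UNIV :: spacetime set)"
    obtain vs y where zz: "z = (vs, y)" by (cases z)
    have "(1 + norm y) ^ N * norm (iter_deriv vs f y) \<le> B vs" using z zz B by auto
    also have "\<dots> \<le> Max (B ` I)" using z zz finI by auto
    finally show "(case z of (vs, y) \<Rightarrow> (1 + norm y) ^ N * norm (iter_deriv vs f y)) \<le> Max (B ` I)"
      using zz by simp
  qed
  from cSUP_upper[OF _ this, of "([], x)"] show ?thesis
    unfolding schwartz_norm_def I_def by (simp add: iter_deriv_def)
qed

text \<open>Supplies enough directions to determine the second functional derivative. In the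
  seminorm of order \<open>N + ?r\<close> the power \<open>N\<close> pays for the growth of
  \<open>p\<close> and \<open>?r\<close> for integrability.\<close>

lemma real_polynomial_function_in_configs:
  assumes "real_polynomial_function p"
  shows "p \<in> configs"
proof -
  let ?T = "\<lambda>f. LINT x|lborel. complex_of_real (p x) * f x"
  obtain C N where p: "C \<ge> 0" "\<And>x. \<bar>p x\<bar> \<le> C * (1 + norm x) ^ N"
    using real_polynomial_function_growth[OF assms] by blast
  let ?r = "2 * DIM(spacetime)"
  define J where "J = (LINT x|lborel. 1 / (1 + norm (x::spacetime)) ^ ?r)"
  have pc: "continuous_on UNIV p"
    using assms smooth_imp_continuous smooth_real_polynomial_function by blast
  have bound: "norm (complex_of_real (p x) * f x) \<le> C * schwartz_norm (N + ?r) f * (1 / (1 + norm x) ^ ?r)"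
    if "f \<in> schwartz_functions" for f x
  proof -
    have pos: "1 + norm x > 0" by (simp add: add_pos_nonneg)
    have "norm (complex_of_real (p x) * f x) * (1 + norm x) ^ ?r
        \<le> C * (1 + norm x) ^ N * norm (f x) * (1 + norm x) ^ ?r"
      by (simp add: norm_mult) (intro mult_right_mono p(2), auto)
    also have "\<dots> = C * ((1 + norm x) ^ (N + ?r) * norm (f x))"
      by (simp only: power_add mult_ac)
    also have "\<dots> \<le> C * schwartz_norm (N + ?r) f"
      using p(1) schwartz_norm_upper[OF that] by (intro mult_left_mono) auto
    finally show ?thesis using pos by (simp only: times_divide_eq_right mult_1_right pos_le_divide_eq zero_less_power)
  qed
  have int: "integrable lborel (\<lambda>x. complex_of_real (p x) * f x)" if "f \<in> schwartz_functions" for f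
  proof (rule Bochner_Integration.integrable_bound)
    show "integrable lborel (\<lambda>x::spacetime. C * schwartz_norm (N + ?r) f * (1 / (1 + norm x) ^ ?r))"
      by (intro integrable_mult_right integrable_one_plus_norm_power)
    have "continuous_on UNIV f"
      using that smooth_imp_continuous by (auto simp: schwartz_functions_def)
    then have "continuous_on UNIV (\<lambda>x. complex_of_real (p x) * f x)"
      by (intro continuous_intros pc)
    then show "(\<lambda>x. complex_of_real (p x) * f x) \<in> borel_measurable lborel"
      using borel_measurable_continuous_onI by simp
    show "AE x in lborel. norm (complex_of_real (p x) * f x)
         \<le> norm (C * schwartz_norm (N + ?r) f * (1 / (1 + norm x) ^ ?r))"
      by (intro AE_I2 order_trans[OF bound[OF that]]) (simp only: real_norm_def abs_ge_self)
  qed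
  have "?T \<in> tempered_distributions"
    unfolding tempered_distributions_def
  proof (intro CollectI conjI ballI allI exI)
    fix f h assume "f \<in> schwartz_functions" "h \<in> schwartz_functions"
    then show "?T (\<lambda>x. f x + h x) = ?T f + ?T h"
      by (simp add: distrib_left int)
  next
    fix c f assume "f \<in> schwartz_functions"
    have "(\<lambda>x. complex_of_real (p x) * (c * f x)) = (\<lambda>x. c * (complex_of_real (p x) * f x))"
      by (simp add: mult_ac)
    then show "?T (\<lambda>x. c * f x) = c * ?T f" by simp
  next
    fix f assume f: "f \<in> schwartz_functions"
    have "norm (?T f) \<le> (LINT x|lborel. C * schwartz_norm (N + ?r) f * (1 / (1 + norm (x::spacetime)) ^ ?r))"
    proof (rule Bochner_Integration.integral_norm_bound_integral)
      show "integrable lborel (\<lambda>x::spacetime. C * schwartz_norm (N + ?r) f * (1 / (1 + norm x) ^ ?r))"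
        by (intro integrable_mult_right integrable_one_plus_norm_power)
    qed (use int[OF f] bound[OF f] in auto)
    also have "\<dots> = C * schwartz_norm (N + ?r) f * J"
      unfolding J_def by (rule integral_mult_right_zero)
    finally show "norm (?T f) \<le> (C * J) * schwartz_norm (N + ?r) f"
      by (simp add: mult_ac)
  qed
  then show ?thesis
    unfolding configs_def
    by (intro CollectI conjI smooth_real_polynomial_function[OF assms] bexI[of _ ?T] ballI refl)
qed

lemma configs_continuous: "\<phi> \<in> configs \<Longrightarrow> continuous_on UNIV \<phi>"
  using smooth_imp_continuous by (auto simp: configs_def)

section \<open>Propagators\<close>

lemma exp_neg_square_le:
  fixes c :: real
  assumes "c > 0"
  obtains K where "K \<ge> 0" "\<And>t. t \<ge> 0 \<Longrightarrow> exp (- (c * t\<^sup>2)) * (1 + t) ^ N \<le> K"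
proof -
  have "((\<lambda>t::real. exp (- (c * t\<^sup>2)) * (1 + t) ^ N) \<longlongrightarrow> 0) at_top"
    using assms by real_asymp
  then have "eventually (\<lambda>t. exp (- (c * t\<^sup>2)) * (1 + t) ^ N < 1) at_top"
    by (rule order_tendstoD) simp
  then obtain R where R: "\<And>t. t \<ge> R \<Longrightarrow> exp (- (c * t\<^sup>2)) * (1 + t) ^ N < 1"
    by (auto simp: eventually_at_top_linorder)
  have "compact ((\<lambda>t. exp (- (c * t\<^sup>2)) * (1 + t) ^ N) ` {0..\<bar>R\<bar>})"
    by (intro compact_continuous_image continuous_intros) auto
  then obtain B where B: "\<And>t. t \<in> {0..\<bar>R\<bar>} \<Longrightarrow> norm (exp (- (c * t\<^sup>2)) * (1 + t) ^ N) \<le> B"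
    using compact_imp_bounded bounded_iff by (metis (no_types, lifting) image_eqI)
  show thesis
  proof (rule that[of "max 1 B"])
    fix t :: real assume t: "t \<ge> 0"
    show "exp (- (c * t\<^sup>2)) * (1 + t) ^ N \<le> max 1 B"
    proof (cases "t \<le> \<bar>R\<bar>")
      case True
      then have "norm (exp (- (c * t\<^sup>2)) * (1 + t) ^ N) \<le> B" using B t by auto
      then show ?thesis using abs_ge_self[of "exp (- (c * t\<^sup>2)) * (1 + t) ^ N"] by simp
    next
      case False
      then have "R \<le> t" by linarith
      from R[OF this] show ?thesis by linarith
    qed
  qed simp
qed

text \<open>The phase has modulus one, so the modulus of the integrand is independent of x:
  \<open>omega m p\<close> is at least \<open>m\<close>, and the Gaussian cutoff beats every power
  of |p|. One function dominates for all x, and continuity is dominated convergence.\<close>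

lemma continuous_Delta_plus:
  assumes "m > 0" "lam > 0"
  shows "continuous_on UNIV (Delta_plus m lam)"
proof -
  let ?f = "\<lambda>x p. complex_of_real (1 / (2 * omega m p)) *
        of_real (exp (- (lam\<^sup>2 * (2 * (norm p)\<^sup>2 + m\<^sup>2)))) *
        exp (- \<i> * of_real (omega m p * fst x - p \<bullet> snd x))"
  have om: "omega m p \<ge> m" for p
    using assms by (simp add: omega_def real_le_rsqrt)
  have omc: "continuous_on UNIV (omega m)"
    unfolding omega_def by (intro continuous_intros)
  have om0: "omega m p \<noteq> 0" for p using om[of p] assms by auto
  obtain K where K: "K \<ge> 0" "\<And>t. t \<ge> 0 \<Longrightarrow> exp (- (2 * lam\<^sup>2 * t\<^sup>2)) * (1 + t) ^ (2 * DIM(real^3)) \<le> K"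
    using exp_neg_square_le[of "2 * lam\<^sup>2"] assms by (metis zero_less_mult_iff zero_less_numeral zero_less_power)
  let ?w = "\<lambda>p::real^3. K / (2 * m) * (1 / (1 + norm p) ^ (2 * DIM(real^3)))"
  have bound: "norm (?f x p) \<le> ?w p" for x p
  proof -
    have "1 / (2 * omega m p) \<le> 1 / (2 * m)"
      using om[of p] assms by (intro divide_left_mono) auto
    moreover have "exp (- (lam\<^sup>2 * (2 * (norm p)\<^sup>2 + m\<^sup>2))) \<le> K / (1 + norm p) ^ (2 * DIM(real^3))"
    proof -
      have "exp (- (lam\<^sup>2 * (2 * (norm p)\<^sup>2 + m\<^sup>2))) \<le> exp (- (2 * lam\<^sup>2 * (norm p)\<^sup>2))"
        by (simp add: algebra_simps)
      also have "\<dots> \<le> K / (1 + norm p) ^ (2 * DIM(real^3))"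
      proof -
        have "1 + norm p > 0" by (simp add: add_pos_nonneg)
        from pos_le_divide_eq[OF zero_less_power[OF this]] show ?thesis using K(2)[of "norm p"] by simp
      qed
      finally show ?thesis .
    qed
    ultimately have "1 / (2 * omega m p) * exp (- (lam\<^sup>2 * (2 * (norm p)\<^sup>2 + m\<^sup>2)))
        \<le> 1 / (2 * m) * (K / (1 + norm p) ^ (2 * DIM(real^3)))"
      using assms by (intro mult_mono) auto
    moreover have "norm (?f x p) = 1 / (2 * omega m p) * exp (- (lam\<^sup>2 * (2 * (norm p)\<^sup>2 + m\<^sup>2)))"
    proof -
      have "norm (exp (- \<i> * complex_of_real (omega m p * fst x - p \<bullet> snd x))) = 1"
        by (simp add: norm_exp_eq_Re)
      moreover have "omega m p > 0" using om[of p] assms by linarith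
      ultimately show ?thesis by (simp only: norm_mult norm_of_real) simp
    qed
    ultimately show ?thesis by simp
  qed
  have meas: "?f x \<in> borel_measurable lborel" for x
  proof -
    have "continuous_on UNIV (?f x)"
      by (intro continuous_intros omc) (use om0 in auto)
    then show ?thesis using borel_measurable_continuous_onI by simp
  qed
  have "isCont (\<lambda>x. LINT p|lborel. ?f x p) x" for x
    unfolding continuous_at_sequentially comp_def
  proof (intro allI impI)
    fix X assume X: "X \<longlonglongrightarrow> x"
    show "(\<lambda>n. LINT p|lborel. ?f (X n) p) \<longlonglongrightarrow> (LINT p|lborel. ?f x p)"
    proof (rule integral_dominated_convergence[where w = ?w])
      show "integrable lborel ?w"
        by (intro integrable_mult_right integrable_one_plus_norm_power)
      show "AE p in lborel. (\<lambda>n. ?f (X n) p) \<longlonglongrightarrow> ?f x p"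
        by (intro AE_I2 tendsto_intros X)
    qed (use bound meas in auto)
  qed
  then show ?thesis
    unfolding Delta_plus_def[abs_def]
    by (intro continuous_intros) (simp add: continuous_on_eq_continuous_at)
qed

lemma cnj_Delta_plus: "cnj (Delta_plus m lam x) = Delta_plus m lam (- x)"
proof -
  let ?f = "\<lambda>x p. complex_of_real (1 / (2 * omega m p)) *
        of_real (exp (- (lam\<^sup>2 * (2 * (norm p)\<^sup>2 + m\<^sup>2)))) *
        exp (- \<i> * of_real (omega m p * fst x - p \<bullet> snd x))"
  have "cnj (exp (- \<i> * complex_of_real (omega m p * fst x - p \<bullet> snd x))) =
      exp (- \<i> * complex_of_real (omega m p * fst (- x) - p \<bullet> snd (- x)))" for p
    by (simp add: exp_cnj algebra_simps)
  then have "cnj (?f x p) = ?f (- x) p" for p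
    by (simp only: complex_cnj_mult complex_cnj_complex_of_real)
  note eq = this
  have "cnj (LINT p|lborel. ?f x p) = (LINT p|lborel. ?f (- x) p)"
    unfolding Bochner_Integration.integral_cnj[symmetric] eq by (rule refl)
  then show ?thesis
    unfolding Delta_plus_def by (simp only: complex_cnj_mult) simp
qed

lemma lborel_distr_uminus_euclidean: "distr lborel borel uminus = (lborel :: 'a::euclidean_space measure)"
  by (subst (2) lborel_affine[of "-1" 0]) (auto simp: density_1 one_ennreal_def[symmetric])

text \<open>At time zero the phase is linear in p, so reflecting p, which leaves
  \<open>omega\<close> and the cutoff fixed, reflects x. The cutoff is not Lorentz invariant, and
  evenness is claimed at equal times only.\<close>

lemma Delta_plus_spacelike_even:
  assumes "fst x = 0"
  shows "Delta_plus m lam (- x) = Delta_plus m lam x"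
proof -
  let ?f = "\<lambda>x p. complex_of_real (1 / (2 * omega m p)) *
        of_real (exp (- (lam\<^sup>2 * (2 * (norm p)\<^sup>2 + m\<^sup>2)))) *
        exp (- \<i> * of_real (omega m p * fst x - p \<bullet> snd x))"
  have omc: "continuous_on UNIV (omega m)"
    unfolding omega_def by (intro continuous_intros)
  have [measurable]: "omega m \<in> borel_measurable borel"
    using omc by (rule borel_measurable_continuous_onI)
  have "(LINT p|lborel. ?f (- x) p) = (LINT p|distr lborel borel uminus. ?f (- x) p)"
    by (simp add: lborel_distr_uminus_euclidean)
  also have "\<dots> = (LINT p|lborel. ?f (- x) (- p))"
    by (rule integral_distr) auto
  also have "\<dots> = (LINT p|lborel. ?f x p)"
    using assms by (simp add: omega_def)
  finally show ?thesis unfolding Delta_plus_def by simp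
qed

lemma Delta_F_uminus: "Delta_F m lam (- x) = Delta_F m lam x"
  by (simp add: Delta_F_def)

text \<open>At time zero \<open>\<theta>(0) = 1/2\<close> averages \<open>\<Delta>\<^sub>+(x)\<close> and \<open>\<Delta>\<^sub>+(-x)\<close>, which agree there; hence the
  formulas below hold on closed half spaces, and equal times need no special treatment.\<close>

lemma Delta_F_nonneg:
  assumes "fst x \<ge> 0"
  shows "Delta_F m lam x = Delta_plus m lam x"
proof (cases "fst x = 0")
  case True
  then show ?thesis
    by (simp add: Delta_F_def heaviside_def Delta_plus_spacelike_even)
next
  case False
  then show ?thesis using assms by (simp add: Delta_F_def heaviside_def)
qed

lemma Delta_F_nonpos:
  assumes "fst x \<le> 0"
  shows "Delta_F m lam x = Delta_plus m lam (- x)"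
  using Delta_F_nonneg[of "- x" m lam] assms by (simp add: Delta_F_uminus)

text \<open>The two half-space formulas agree on the common boundary, so they can be pasted.
  \<open>Gamma_eq\<close> can then be applied to \<open>Delta_F\<close>, for which no smoothness
  across time zero is available.\<close>

lemma continuous_Delta_F:
  assumes "m > 0" "lam > 0"
  shows "continuous_on UNIV (Delta_F m lam)"
proof -
  have c: "continuous_on UNIV (Delta_plus m lam)" by (rule continuous_Delta_plus[OF assms])
  have "continuous_on ({x. 0 \<le> fst x} \<union> {x. fst x \<le> 0}) (Delta_F m lam)"
  proof (rule continuous_on_closed_Un)
    show "closed {x::spacetime. 0 \<le> fst x}" "closed {x::spacetime. fst x \<le> 0}"
      by (intro closed_Collect_le continuous_intros)+
    show "continuous_on {x. 0 \<le> fst x} (Delta_F m lam)"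
      using continuous_on_subset[OF c] by (subst continuous_on_cong[OF refl Delta_F_nonneg]) auto
    show "continuous_on {x. fst x \<le> 0} (Delta_F m lam)"
      by (subst continuous_on_cong[OF refl Delta_F_nonpos])
        (auto intro!: continuous_on_compose2[OF c] continuous_intros)
  qed
  moreover have "{x::spacetime. 0 \<le> fst x} \<union> {x. fst x \<le> 0} = UNIV" by auto
  ultimately show ?thesis by simp
qed

section \<open>Uniqueness of the second functional derivative\<close>

text \<open>The span of the functions on which a second functional derivative is prescribed,
  restricted to polynomial factors; scalars are absorbed into \<open>h\<close>.\<close>

inductive tensor_polynomial :: "(spacetime \<times> spacetime \<Rightarrow> real) \<Rightarrow> bool" where
  pure: "real_polynomial_function h \<Longrightarrow> real_polynomial_function k \<Longrightarrow>
      tensor_polynomial (\<lambda>(x, y). h x * k y)"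
| add: "tensor_polynomial p \<Longrightarrow> tensor_polynomial q \<Longrightarrow> tensor_polynomial (\<lambda>z. p z + q z)"

lemma tensor_polynomial_mult:
  assumes "tensor_polynomial p" "tensor_polynomial q"
  shows "tensor_polynomial (\<lambda>z. p z * q z)"
  using assms
proof (induction arbitrary: q)
  case (pure h k)
  note hk = pure(1,2)
  from pure(3) show ?case
  proof (induction)
    case (pure h' k')
    have "tensor_polynomial (\<lambda>(x, y). (h x * h' x) * (k y * k' y))"
      by (intro tensor_polynomial.pure real_polynomial_function.intros(4) hk pure)
    moreover have "(\<lambda>(x, y). (h x * h' x) * (k y * k' y)) =
        (\<lambda>z. (case z of (x, y) \<Rightarrow> h x * k y) * (case z of (x, y) \<Rightarrow> h' x * k' y))"
      by (auto simp: fun_eq_iff)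
    ultimately show ?case by simp
  next
    case (add p q)
    from tensor_polynomial.add[OF add(3,4)] show ?case by (simp add: distrib_left)
  qed
next
  case (add p p')
  from tensor_polynomial.add[OF add(3)[OF add(5)] add(4)[OF add(5)]] show ?case
    by (simp add: distrib_right)
qed

text \<open>A linear form on the product splits as f (x, 0) + f (0, y), and the span is closed under
  products.\<close>

lemma real_polynomial_imp_tensor_polynomial:
  assumes "real_polynomial_function p"
  shows "tensor_polynomial p"
  using assms
proof induction
  case (linear f)
  have "bounded_linear (\<lambda>x::spacetime. f (x, 0))" "bounded_linear (\<lambda>y::spacetime. f (0, y))"
    by (auto intro!: bounded_linear_compose[OF linear] bounded_linear_Pair bounded_linear_ident bounded_linear_zero)
  note lin = this[THEN real_polynomial_function.intros(1)]
  from tensor_polynomial.pure[OF lin(1) real_polynomial_function.intros(2)]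
    tensor_polynomial.pure[OF real_polynomial_function.intros(2) lin(2)]
  have "tensor_polynomial (\<lambda>(x, y). f (x, 0) * 1)" "tensor_polynomial (\<lambda>(x, y). 1 * f (0, y))" .
  from tensor_polynomial.add[OF this]
  have "tensor_polynomial (\<lambda>z. f (fst z, 0) + f (0, snd z))" by (simp add: case_prod_beta)
  moreover have "f (fst z, 0) + f (0, snd z) = f z" for z
  proof -
    have "f (fst z, 0) + f (0, snd z) = f ((fst z, 0) + (0, snd z))"
      using linear by (simp only: linear_add bounded_linear.linear)
    then show ?thesis by simp
  qed
  ultimately show ?case by simp
next
  case (const c)
  have "(\<lambda>z. c) = (\<lambda>(x::spacetime, y::spacetime). c * 1)" by auto
  with tensor_polynomial.pure[OF real_polynomial_function.intros(2)[of c] real_polynomial_function.intros(2)[of 1]]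
  show ?case by simp
next
  case (add f g)
  then show ?case by (intro tensor_polynomial.add)
next
  case (mult f g)
  then show ?case by (intro tensor_polynomial_mult)
qed

lemma continuous_tensor_polynomial: "tensor_polynomial p \<Longrightarrow> continuous_on UNIV p"
proof (induction rule: tensor_polynomial.induct)
  case (pure h k)
  have "continuous_on UNIV h" "continuous_on UNIV k"
    using pure[THEN real_polynomial_function_in_configs, THEN configs_continuous] .
  then show ?case unfolding case_prod_beta'
    by (intro continuous_on_mult continuous_on_compose2[of UNIV h UNIV fst]
        continuous_on_compose2[of UNIV k UNIV snd] continuous_on_fst continuous_on_snd continuous_on_id) auto
qed (auto intro: continuous_intros)

text \<open>Both forms see \<open>u\<close> only on the compact set \<open>K1 \<union> K2\<close>.
  There Stone-Weierstrass approximates its real and imaginary parts by polynomials, which are sums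
  of products h(x) k(y) and hence treated alike by \<open>T\<close> and \<open>S\<close>.\<close>

lemma radon2_eqI:
  assumes T: "radon2 T" and S: "radon2 S"
    and eq: "\<And>h k. h \<in> configs \<Longrightarrow> k \<in> configs \<Longrightarrow>
        T (\<lambda>(x, y). complex_of_real (h x * k y)) = S (\<lambda>(x, y). complex_of_real (h x * k y))"
    and u: "continuous_on UNIV u"
  shows "T u = S u"
proof -
  have Tadd: "T (\<lambda>z. u z + v z) = T u + T v" if "continuous_on UNIV u" "continuous_on UNIV v" for u v
    using T that unfolding radon2_def by blast
  have Sadd: "S (\<lambda>z. u z + v z) = S u + S v" if "continuous_on UNIV u" "continuous_on UNIV v" for u v
    using S that unfolding radon2_def by blast
  have Tmul: "T (\<lambda>z. c * u z) = c * T u" if "continuous_on UNIV u" for u c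
    using T that unfolding radon2_def by blast
  have Smul: "S (\<lambda>z. c * u z) = c * S u" if "continuous_on UNIV u" for u c
    using S that unfolding radon2_def by blast
  obtain K1 C1 where K1: "compact K1"
    "\<And>u B. continuous_on UNIV u \<Longrightarrow> (\<forall>z\<in>K1. norm (u z) \<le> B) \<Longrightarrow> norm (T u) \<le> C1 * B"
    using T that unfolding radon2_def by (elim conjE exE) meson
  obtain K2 C2 where K2: "compact K2"
    "\<And>u B. continuous_on UNIV u \<Longrightarrow> (\<forall>z\<in>K2. norm (u z) \<le> B) \<Longrightarrow> norm (S u) \<le> C2 * B"
    using S that unfolding radon2_def by (elim conjE exE) meson
  have cof: "continuous_on UNIV (\<lambda>z. complex_of_real (p z))" if "tensor_polynomial p" for p
    using continuous_tensor_polynomial[OF that] by (intro continuous_intros)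
  have poly: "T (\<lambda>z. complex_of_real (p z)) = S (\<lambda>z. complex_of_real (p z))" if "tensor_polynomial p" for p
    using that
  proof (induction)
    case (pure h k)
    from eq[OF pure[THEN real_polynomial_function_in_configs]] show ?case
      by (simp only: case_prod_beta')
  next
    case (add p q)
    then show ?case using Tadd[OF cof cof] Sadd[OF cof cof] by simp
  qed
  have le: "norm (T u - S u) \<le> (\<bar>C1\<bar> + \<bar>C2\<bar>) * (2 * e)" if e: "e > 0" for e
  proof -
    have cK: "compact (K1 \<union> K2)" using K1 K2 by auto
    have cR: "continuous_on (K1 \<union> K2) (\<lambda>z. Re (u z))" "continuous_on (K1 \<union> K2) (\<lambda>z. Im (u z))"
      using u by (auto intro!: continuous_intros elim: continuous_on_subset)
    obtain p where p: "real_polynomial_function p" "\<And>z. z \<in> K1 \<union> K2 \<Longrightarrow> \<bar>Re (u z) - p z\<bar> < e"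
      using Stone_Weierstrass_real_polynomial_function[OF cK cR(1) e] by blast
    obtain q where q: "real_polynomial_function q" "\<And>z. z \<in> K1 \<union> K2 \<Longrightarrow> \<bar>Im (u z) - q z\<bar> < e"
      using Stone_Weierstrass_real_polynomial_function[OF cK cR(2) e] by blast
    have pq: "tensor_polynomial p" "tensor_polynomial q"
      using p q real_polynomial_imp_tensor_polynomial by auto
    define P where "P z = complex_of_real (p z) + \<i> * complex_of_real (q z)" for z
    have Pc: "continuous_on UNIV P" unfolding P_def by (intro continuous_intros cof pq)
    have TP: "T P = S P"
      unfolding P_def using pq poly cof
      by (simp add: Tadd Sadd Tmul Smul continuous_on_mult_left)
    \<comment> \<open>Written as a sum with a scalar multiple, the two operations for which
      \<open>radon2\<close> gives linearity.\<close>
    define d where "d z = u z + (-1) * P z" for z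
    have dc: "continuous_on UNIV d" unfolding d_def by (intro continuous_intros u Pc)
    have dT: "T d = T u - T P" unfolding d_def
      by (subst Tadd) (use u Pc Tmul[OF Pc, of "-1"] in \<open>auto intro!: continuous_intros\<close>)
    have dS: "S d = S u - S P" unfolding d_def
      by (subst Sadd) (use u Pc Smul[OF Pc, of "-1"] in \<open>auto intro!: continuous_intros\<close>)
    have db: "norm (d z) \<le> 2 * e" if "z \<in> K1 \<union> K2" for z
    proof -
      have "norm (d z) \<le> \<bar>Re (d z)\<bar> + \<bar>Im (d z)\<bar>" by (rule cmod_le)
      also have "\<dots> \<le> e + e" using p(2)[OF that] q(2)[OF that] by (simp add: d_def P_def)
      finally show ?thesis by simp
    qed
    have "norm (T d) \<le> C1 * (2 * e)" "norm (S d) \<le> C2 * (2 * e)"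
      using K1(2)[OF dc] K2(2)[OF dc] db by auto
    moreover have "C1 * (2 * e) \<le> \<bar>C1\<bar> * (2 * e)" "C2 * (2 * e) \<le> \<bar>C2\<bar> * (2 * e)"
      using e by (auto intro!: mult_right_mono)
    moreover have "T u - S u = T d - S d" using dT dS TP by simp
    ultimately show ?thesis
      using norm_triangle_ineq4[of "T d" "S d"] by (simp add: distrib_right)
  qed
  have "norm (T u - S u) \<le> 0"
  proof (rule field_le_epsilon)
    fix e :: real assume e: "e > 0"
    \<comment> \<open>The added 1 keeps the divisor positive when both constants vanish.\<close>
    let ?c = "\<bar>C1\<bar> + \<bar>C2\<bar> + 1"
    have scale: "a * (2 * (e / (2 * c))) = e * (a / c)" for a c :: real by simp
    have "norm (T u - S u) \<le> (\<bar>C1\<bar> + \<bar>C2\<bar>) * (2 * (e / (2 * ?c)))"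
      using e by (intro le) auto
    also have "\<dots> = e * ((\<bar>C1\<bar> + \<bar>C2\<bar>) / ?c)" by (rule scale)
    also have "\<dots> \<le> e" using e by (intro mult_right_le_one_le) auto
    finally show "norm (T u - S u) \<le> 0 + e" by simp
  qed
  then show ?thesis by simp
qed

text \<open>The inner derivative is unique at every s, so the two witnesses coincide as functions of
  s and their outer derivatives can be compared.\<close>

lemma mixed_deriv_unique:
  assumes T: "mixed_deriv F \<phi> \<psi> T" and S: "mixed_deriv F \<phi> \<psi> S" and u: "continuous_on UNIV u"
  shows "T u = S u"
proof (rule radon2_eqI[OF _ _ _ u])
  show "radon2 T" "radon2 S" using T S by (auto simp: mixed_deriv_def)
  fix h k assume hk: "h \<in> configs" "k \<in> configs"
  obtain d where d: "\<And>s. ((\<lambda>t. F (\<lambda>x. \<phi> x + s * h x) (\<lambda>y. \<psi> y + t * k y)) has_vector_derivative d s) (at 0)"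
     "(d has_vector_derivative T (\<lambda>(x, y). complex_of_real (h x * k y))) (at 0)"
    using T hk unfolding mixed_deriv_def by blast
  obtain e where e: "\<And>s. ((\<lambda>t. F (\<lambda>x. \<phi> x + s * h x) (\<lambda>y. \<psi> y + t * k y)) has_vector_derivative e s) (at 0)"
     "(e has_vector_derivative S (\<lambda>(x, y). complex_of_real (h x * k y))) (at 0)"
    using S hk unfolding mixed_deriv_def by blast
  have "d = e" using vector_derivative_unique_at[OF d(1) e(1)] by (intro ext)
  then show "T (\<lambda>(x, y). complex_of_real (h x * k y)) = S (\<lambda>(x, y). complex_of_real (h x * k y))"
    using vector_derivative_unique_at d(2) e(2) by blast
qed

text \<open>Replaces the chosen derivative by any explicit one. Since D(x - y) is not a product of
  configurations, agreement on all continuous functions is what matters.\<close>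

lemma Gamma_eq:
  assumes T: "mixed_deriv F \<phi> \<psi> T" and D: "continuous_on UNIV D"
  shows "Gamma D F \<phi> \<psi> = T (\<lambda>(x, y). D (x - y))"
  unfolding Gamma_def
proof (rule mixed_deriv_unique[OF _ T])
  show "mixed_deriv F \<phi> \<psi> (SOME T. mixed_deriv F \<phi> \<psi> T)" by (rule someI[of "mixed_deriv F \<phi> \<psi>", OF T])
  show "continuous_on UNIV (\<lambda>(x, y). D (x - y))"
    unfolding case_prod_beta' by (intro continuous_on_compose2[OF D] continuous_intros) auto
qed

section \<open>Functional derivatives of polynomial functionals\<close>

abbreviation config_measure :: "nat set \<Rightarrow> (nat \<Rightarrow> spacetime) measure" where
  "config_measure V \<equiv> Pi\<^sub>M V (\<lambda>_. lborel)"

interpretation spacetime_prod: product_sigma_finite "\<lambda>_::nat. lborel :: spacetime measure"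
  by (rule product_sigma_finite.intro) (rule lborel.sigma_finite_measure_axioms)

section \<open>Integrands bounded over the support of the source\<close>

definition tame :: "nat set \<Rightarrow> spacetime set \<Rightarrow> ((nat \<Rightarrow> spacetime) \<Rightarrow> complex) \<Rightarrow> bool" where
  "tame V K u \<longleftrightarrow> u \<in> borel_measurable (config_measure V) \<and>
     (\<exists>B. \<forall>x. (\<forall>i\<in>V. x i \<in> K) \<longrightarrow> norm (u x) \<le> B)"

lemma tame_const: "tame V K (\<lambda>x. c)"
  by (auto simp: tame_def)

lemma tame_add:
  assumes "tame V K u" "tame V K v"
  shows "tame V K (\<lambda>x. u x + v x)"
proof -
  obtain B C where "\<And>x. (\<forall>i\<in>V. x i \<in> K) \<Longrightarrow> norm (u x) \<le> B" "\<And>x. (\<forall>i\<in>V. x i \<in> K) \<Longrightarrow> norm (v x) \<le> C"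
    using assms unfolding tame_def by metis
  then have "norm (u x + v x) \<le> B + C" if "\<forall>i\<in>V. x i \<in> K" for x
    using that by (intro norm_triangle_mono) auto
  then show ?thesis using assms unfolding tame_def by (intro conjI exI[of _ "B + C"]) auto
qed

lemma tame_mult:
  assumes "tame V K u" "tame V K v"
  shows "tame V K (\<lambda>x. u x * v x)"
proof -
  obtain B C where B: "\<And>x. (\<forall>i\<in>V. x i \<in> K) \<Longrightarrow> norm (u x) \<le> B"
    and C: "\<And>x. (\<forall>i\<in>V. x i \<in> K) \<Longrightarrow> norm (v x) \<le> C"
    using assms unfolding tame_def by metis
  have "norm (u x * v x) \<le> B * C" if "\<forall>i\<in>V. x i \<in> K" for x
    using B[OF that] C[OF that] norm_ge_zero order_trans unfolding norm_mult by (intro mult_mono) blast+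
  then show ?thesis using assms unfolding tame_def by (intro conjI exI[of _ "B * C"]) auto
qed

lemma tame_sum: "(\<And>a. a \<in> A \<Longrightarrow> tame V K (u a)) \<Longrightarrow> tame V K (\<lambda>x. \<Sum>a\<in>A. u a x)"
  by (induction A rule: infinite_finite_induct) (auto intro: tame_const tame_add)

lemma tame_prod: "(\<And>a. a \<in> A \<Longrightarrow> tame V K (u a)) \<Longrightarrow> tame V K (\<lambda>x. \<Prod>a\<in>A. u a x)"
  by (induction A rule: infinite_finite_induct) (auto intro: tame_const tame_mult)

lemma tame_norm:
  assumes "tame V K u"
  shows "tame V K (\<lambda>x. complex_of_real (norm (u x)))"
proof -
  have [measurable]: "u \<in> borel_measurable (config_measure V)" using assms by (simp add: tame_def)
  have "(\<lambda>x. complex_of_real (norm (u x))) \<in> borel_measurable (config_measure V)" by measurable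
  then show ?thesis using assms by (simp add: tame_def)
qed

lemma tame_power: "tame V K u \<Longrightarrow> tame V K (\<lambda>x. u x ^ k)"
  by (induction k) (auto intro: tame_const tame_mult)

lemma tame_pair:
  assumes u: "continuous_on UNIV u" and K: "compact K" and "i \<in> V" "j \<in> V"
  shows "tame V K (\<lambda>x. u (x i, x j))"
proof -
  have "u \<in> borel_measurable borel" using u by (rule borel_measurable_continuous_onI)
  then have [measurable]: "u \<in> borel_measurable (borel \<Otimes>\<^sub>M borel)" by (simp add: borel_prod)
  have [measurable]: "(\<lambda>x. x l) \<in> borel_measurable (config_measure V)" if "l \<in> V" for l
    using measurable_component_singleton[OF that, of "\<lambda>_. lborel :: spacetime measure"] by simp
  have m: "(\<lambda>x. u (x i, x j)) \<in> borel_measurable (config_measure V)"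
    using \<open>i \<in> V\<close> \<open>j \<in> V\<close> by measurable
  have "compact (u ` (K \<times> K))"
    using u by (intro compact_continuous_image compact_Times K) (auto elim: continuous_on_subset)
  then obtain B where "\<And>z. z \<in> K \<times> K \<Longrightarrow> norm (u z) \<le> B"
    by (meson bounded_iff compact_imp_bounded imageI)
  with m assms(3,4) show ?thesis unfolding tame_def by (intro conjI exI[of _ B]) auto
qed

lemma tame_component:
  assumes "continuous_on UNIV u" "compact K" "i \<in> V"
  shows "tame V K (\<lambda>x. u (x i))"
proof -
  have "continuous_on UNIV (\<lambda>z. u (fst z :: spacetime))"
    by (intro continuous_on_compose2[OF assms(1)] continuous_on_fst continuous_on_id) auto
  from tame_pair[OF this assms(2,3,3)] show ?thesis by simp
qed

text \<open>Polynomials in a variation parameter whose coefficients depend on the vertex positions.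
  The degree bound is uniform in x, so that integration over x yields one polynomial in the
  parameter.\<close>

definition tame_poly :: "nat set \<Rightarrow> spacetime set \<Rightarrow> ((nat \<Rightarrow> spacetime) \<Rightarrow> complex poly) \<Rightarrow> bool" where
  "tame_poly V K Q \<longleftrightarrow> (\<exists>N. \<forall>x. degree (Q x) \<le> N) \<and> (\<forall>r. tame V K (\<lambda>x. coeff (Q x) r))"

lemma tame_poly_linear:
  assumes "tame V K a" "tame V K b"
  shows "tame_poly V K (\<lambda>x. [:a x, b x:])"
proof -
  have "coeff [:a x, b x:] r = (if r = 0 then a x else if r = 1 then b x else 0)" for x r
    by (auto simp: coeff_pCons split: nat.split)
  moreover have "tame V K (\<lambda>x. if r = 0 then a x else if r = 1 then b x else 0)" for r :: nat
    using assms tame_const by (cases "r = 0"; cases "r = 1") auto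
  ultimately show ?thesis unfolding tame_poly_def by (auto intro!: exI[of _ 1])
qed

lemma tame_poly_smult:
  assumes "tame V K a" "tame_poly V K Q"
  shows "tame_poly V K (\<lambda>x. smult (a x) (Q x))"
proof -
  obtain N where "\<And>x. degree (Q x) \<le> N" using assms by (auto simp: tame_poly_def)
  then have "degree (smult (a x) (Q x)) \<le> N" for x
    using degree_smult_le order_trans by blast
  then show ?thesis using assms by (auto simp: tame_poly_def intro!: tame_mult)
qed

lemma tame_poly_mult:
  assumes "tame_poly V K P" "tame_poly V K Q"
  shows "tame_poly V K (\<lambda>x. P x * Q x)"
proof -
  obtain N M where NM: "\<And>x. degree (P x) \<le> N" "\<And>x. degree (Q x) \<le> M"
    using assms by (auto simp: tame_poly_def)
  have "degree (P x * Q x) \<le> N + M" for x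
    using degree_mult_le[of "P x" "Q x"] NM(1)[of x] NM(2)[of x] by linarith
  then show ?thesis using assms
    by (auto simp: tame_poly_def coeff_mult intro!: tame_sum tame_mult)
qed

lemma tame_poly_prod:
  assumes "\<And>a. a \<in> A \<Longrightarrow> tame_poly V K (Q a)"
  shows "tame_poly V K (\<lambda>x. \<Prod>a\<in>A. Q a x)"
proof -
  have 1: "tame_poly V K (\<lambda>x. 1)"
    using tame_poly_linear[OF tame_const[of V K 1] tame_const[of V K 0]] by (simp add: one_pCons)
  show ?thesis using assms
    by (induction A rule: infinite_finite_induct) (auto intro: 1 tame_poly_mult)
qed

lemma tame_poly_power: "tame_poly V K Q \<Longrightarrow> tame_poly V K (\<lambda>x. Q x ^ k)"
  using tame_poly_prod[of "{..<k}" V K "\<lambda>_. Q"] by simp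

lemma tame_poly_sum:
  assumes "\<And>a. a \<in> A \<Longrightarrow> tame_poly V K (Q a)"
  shows "tame_poly V K (\<lambda>x. \<Sum>a\<in>A. Q a x)"
proof -
  have add: "tame_poly V K (\<lambda>x. P x + Q x)" if PQ: "tame_poly V K P" "tame_poly V K Q" for P Q
  proof -
    obtain N M where NM: "\<And>x. degree (P x) \<le> N" "\<And>x. degree (Q x) \<le> M"
      using PQ by (auto simp: tame_poly_def)
    have "degree (P x + Q x) \<le> max N M" for x
      using degree_add_le_max[of "P x" "Q x"] NM(1)[of x] NM(2)[of x] by linarith
    then show ?thesis using PQ by (auto simp: tame_poly_def intro!: tame_add)
  qed
  have 0: "tame_poly V K (\<lambda>x. 0)"
    using tame_poly_linear[OF tame_const[of V K 0] tame_const[of V K 0]] by simp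
  show ?thesis using assms
    by (induction A rule: infinite_finite_induct) (auto intro: 0 add)
qed

text \<open>\<open>K\<close> is nonempty because the bound \<open>B\<close> in \<^const>\<open>radon2\<close> may be negative when \<open>K\<close> is empty.\<close>

locale source =
  fixes g :: "spacetime \<Rightarrow> real" and K :: "spacetime set"
  assumes cont_g: "continuous_on UNIV g" and compact_K: "compact K" and K_nonempty: "K \<noteq> {}"
    and supp_g: "\<And>z. g z \<noteq> 0 \<Longrightarrow> z \<in> K"
begin

definition G :: "nat set \<Rightarrow> (nat \<Rightarrow> spacetime) \<Rightarrow> complex" where
  "G V x = (\<Prod>i\<in>V. complex_of_real (g (x i)))"

lemma integrable_g: "integrable lborel g"
proof -
  have "integrable lborel (\<lambda>x. indicator K x *\<^sub>R g x)"
    using cont_g by (intro borel_integrable_compact compact_K) (auto elim: continuous_on_subset)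
  moreover have "(\<lambda>x. indicator K x *\<^sub>R g x) = g"
    using supp_g by (auto simp: indicator_def fun_eq_iff)
  ultimately show ?thesis by simp
qed

lemma G_eq_0: "finite V \<Longrightarrow> i \<in> V \<Longrightarrow> x i \<notin> K \<Longrightarrow> G V x = 0"
  unfolding G_def using supp_g[of "x i"] by (auto intro!: bexI[of _ i])

lemma integrable_G: "finite V \<Longrightarrow> integrable (config_measure V) (G V)"
  unfolding G_def[abs_def]
  by (intro spacetime_prod.product_integrable_prod integrable_of_real integrable_g)

lemma norm_G_mult_le:
  assumes "finite V" "\<And>x. (\<forall>i\<in>V. x i \<in> K) \<Longrightarrow> norm (u x) \<le> B"
  shows "norm (G V x * u x) \<le> norm (complex_of_real B * G V x)"
proof (cases "\<forall>i\<in>V. x i \<in> K")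
  case True
  then have "norm (u x) \<le> B" by (rule assms(2))
  then show ?thesis by (simp add: norm_mult mult.commute mult_right_mono)
next
  case False
  then show ?thesis using assms(1) G_eq_0 by auto
qed

text \<open>Fields may be unbounded, but \<open>G\<close> vanishes unless every vertex lies in
  \<open>K\<close>. A bound over such positions, as in \<open>tame\<close>, therefore
  suffices.\<close>

lemma integrable_G_tame:
  assumes "finite V" "tame V K u"
  shows "integrable (config_measure V) (\<lambda>x. G V x * u x)"
proof -
  obtain B where B: "\<And>x. (\<forall>i\<in>V. x i \<in> K) \<Longrightarrow> norm (u x) \<le> B"
    using assms by (auto simp: tame_def)
  show ?thesis
  proof (rule Bochner_Integration.integrable_bound)
    show "integrable (config_measure V) (\<lambda>x. complex_of_real B * G V x)"
      by (intro integrable_mult_right integrable_G assms)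
    show "(\<lambda>x. G V x * u x) \<in> borel_measurable (config_measure V)"
      using assms integrable_G[of V] by (auto simp: tame_def)
    show "AE x in config_measure V. norm (G V x * u x) \<le> norm (complex_of_real B * G V x)"
      by (intro AE_I2 norm_G_mult_le assms B)
  qed
qed

section \<open>Differentiation of polynomial functionals\<close>

lemma has_vector_derivative_integral_tame_poly:
  assumes V: "finite V" and Q: "tame_poly V K Q"
  shows "((\<lambda>s. LINT x|config_measure V. G V x * poly (Q x) (complex_of_real s)) has_vector_derivative
     (LINT x|config_measure V. G V x * poly (pderiv (Q x)) 0)) (at 0)"
proof -
  obtain N where N: "\<And>x. degree (Q x) \<le> N" using Q by (auto simp: tame_poly_def)
  have int: "integrable (config_measure V) (\<lambda>x. G V x * coeff (Q x) r)" for r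
    using Q by (intro integrable_G_tame V) (auto simp: tame_poly_def)
  \<comment> \<open>Summing up to \<open>Suc N\<close> keeps the linear coefficient, which is the
    derivative at 0, in the sum even if \<open>N\<close> is 0.\<close>
  define P where "P = (\<Sum>r\<le>Suc N. monom (LINT x|config_measure V. G V x * coeff (Q x) r) r)"
  have "(LINT x|config_measure V. G V x * poly (Q x) z) = poly P z" for z
  proof -
    have "poly (Q x) z = (\<Sum>r\<le>Suc N. coeff (Q x) r * z ^ r)" for x
    proof -
      have "degree (Q x) \<le> Suc N" using N[of x] by simp
      then show ?thesis using poly_as_sum_of_monoms'[of "Q x" "Suc N"]
        by (metis (no_types, lifting) poly_monom poly_sum sum.cong)
    qed
    then have "(LINT x|config_measure V. G V x * poly (Q x) z)
        = (LINT x|config_measure V. (\<Sum>r\<le>Suc N. (G V x * coeff (Q x) r) * z ^ r))"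
      by (simp only: sum_distrib_left mult.assoc)
    also have "\<dots> = (\<Sum>r\<le>Suc N. LINT x|config_measure V. (G V x * coeff (Q x) r) * z ^ r)"
      by (intro Bochner_Integration.integral_sum integrable_mult_left int)
    also have "\<dots> = poly P z"
      unfolding P_def poly_sum poly_monom by (simp only: integral_mult_left_zero)
    finally show ?thesis .
  qed
  moreover have "((\<lambda>s. poly P (complex_of_real s)) has_vector_derivative poly (pderiv P) (complex_of_real 0)) (at 0)"
    by (intro has_vector_derivative_real_field poly_DERIV)
  moreover have "poly (pderiv P) (complex_of_real 0) = (LINT x|config_measure V. G V x * poly (pderiv (Q x)) 0)"
    by (simp add: P_def poly_0_coeff_0 coeff_pderiv coeff_sum del: sum.atMost_Suc)
  ultimately show ?thesis by simp
qed


text \<open>Vertices in \<open>X\<close> carry the first field and those in \<open>Y\<close> the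
  second, but the coefficients \<open>f\<close> may couple all of them: after one contraction the
  functional is no longer a sum of separately integrated products.\<close>

definition polynomial_functional ::
  "nat set \<Rightarrow> nat set \<Rightarrow> 'm set \<Rightarrow> ('m \<Rightarrow> (nat \<Rightarrow> spacetime) \<Rightarrow> complex) \<Rightarrow> ('m \<Rightarrow> nat \<Rightarrow> nat) \<Rightarrow> functional2" where
  "polynomial_functional X Y S f p \<phi> \<psi> =
     (LINT x|config_measure (X \<union> Y). G (X \<union> Y) x *
       (\<Sum>m\<in>S. f m x * (\<Prod>i\<in>X. complex_of_real (\<phi> (x i)) ^ p m i) * (\<Prod>j\<in>Y. complex_of_real (\<psi> (x j)) ^ p m j)))"

text \<open>The integrand of the second functional derivative of \<^term>\<open>polynomial_functional X Y S f p\<close>,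
  paired with \<open>u\<close>. The truncated exponents are harmless: they come with the factor \<^term>\<open>p m i\<close>.\<close>

definition mixed_kernel ::
  "nat set \<Rightarrow> nat set \<Rightarrow> 'm set \<Rightarrow> ('m \<Rightarrow> (nat \<Rightarrow> spacetime) \<Rightarrow> complex) \<Rightarrow> ('m \<Rightarrow> nat \<Rightarrow> nat) \<Rightarrow>
     (spacetime \<Rightarrow> real) \<Rightarrow> (spacetime \<Rightarrow> real) \<Rightarrow> (spacetime \<times> spacetime \<Rightarrow> complex) \<Rightarrow> (nat \<Rightarrow> spacetime) \<Rightarrow> complex" where
  "mixed_kernel X Y S f p \<phi> \<psi> u x =
     (\<Sum>m\<in>S. f m x * (\<Sum>i\<in>X. \<Sum>j\<in>Y. u (x i, x j) *
        (of_nat (p m i) * (\<Prod>l\<in>X. complex_of_real (\<phi> (x l)) ^ (p m l - of_bool (l = i)))) *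
        (of_nat (p m j) * (\<Prod>l\<in>Y. complex_of_real (\<psi> (x l)) ^ (p m l - of_bool (l = j))))))"

lemma tame_field_prod:
  assumes "continuous_on UNIV \<phi>" "X \<subseteq> V"
  shows "tame V K (\<lambda>x. \<Prod>i\<in>X. complex_of_real (\<phi> (x i)) ^ p i)"
proof (intro tame_prod tame_power)
  fix i assume "i \<in> X"
  moreover have "continuous_on UNIV (\<lambda>z. complex_of_real (\<phi> z))"
    using assms by (intro continuous_intros)
  ultimately show "tame V K (\<lambda>x. complex_of_real (\<phi> (x i)))"
    using tame_component compact_K assms(2) by blast
qed

lemma tame_mixed_kernel:
  assumes "\<And>m. m \<in> S \<Longrightarrow> tame (X \<union> Y) K (f m)"
    and "continuous_on UNIV \<phi>" "continuous_on UNIV \<psi>" "continuous_on UNIV u"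
  shows "tame (X \<union> Y) K (mixed_kernel X Y S f p \<phi> \<psi> u)"
  unfolding mixed_kernel_def[abs_def]
  by (intro tame_sum tame_mult tame_const assms tame_field_prod tame_pair compact_K) auto

text \<open>The form has order zero because \<open>u\<close> enters undifferentiated. Its constant
  is a bound \<open>\<bar>B0\<bar>\<close> for the coefficients of \<open>u\<close> over
  \<open>K\<close>, times the L1 norm \<open>J\<close> of \<open>G\<close>.\<close>

lemma radon2_mixed_kernel:
  assumes fin: "finite X" "finite Y"
    and f: "\<And>m. m \<in> S \<Longrightarrow> tame (X \<union> Y) K (f m)"
    and \<phi>: "continuous_on UNIV \<phi>" and \<psi>: "continuous_on UNIV \<psi>"
  shows "radon2 (\<lambda>u. LINT x|config_measure (X \<union> Y). G (X \<union> Y) x * mixed_kernel X Y S f p \<phi> \<psi> u x)"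
proof -
  let ?V = "X \<union> Y"
  have finV: "finite ?V" using fin by simp
  have int: "integrable (config_measure ?V) (\<lambda>x. G ?V x * mixed_kernel X Y S f p \<phi> \<psi> u x)"
    if "continuous_on UNIV u" for u
    by (intro integrable_G_tame finV tame_mixed_kernel f \<phi> \<psi> that)
  define c where "c m i j x = f m x * 
        (of_nat (p m i) * (\<Prod>l\<in>X. complex_of_real (\<phi> (x l)) ^ (p m l - of_bool (l = i)))) *
        (of_nat (p m j) * (\<Prod>l\<in>Y. complex_of_real (\<psi> (x l)) ^ (p m l - of_bool (l = j))))" for m i j x
  have kernel_c: "mixed_kernel X Y S f p \<phi> \<psi> u x = (\<Sum>m\<in>S. \<Sum>i\<in>X. \<Sum>j\<in>Y. c m i j x * u (x i, x j))" for u x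
    unfolding mixed_kernel_def c_def by (simp add: sum_distrib_left mult_ac)
  have "tame ?V K (c m i j)" if "m \<in> S" for m i j
    unfolding c_def[abs_def] by (intro tame_mult tame_const f that tame_field_prod \<phi> \<psi>) auto
  then have "tame ?V K (\<lambda>x. \<Sum>m\<in>S. \<Sum>i\<in>X. \<Sum>j\<in>Y. complex_of_real (norm (c m i j x)))"
    by (intro tame_sum tame_norm)
  then obtain B0 where B0: "\<And>x. (\<forall>i\<in>?V. x i \<in> K) \<Longrightarrow>
      norm (\<Sum>m\<in>S. \<Sum>i\<in>X. \<Sum>j\<in>Y. complex_of_real (norm (c m i j x))) \<le> B0"
    unfolding tame_def by auto
  have B0': "(\<Sum>m\<in>S. \<Sum>i\<in>X. \<Sum>j\<in>Y. norm (c m i j x)) \<le> \<bar>B0\<bar>" if "\<forall>i\<in>?V. x i \<in> K" for x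
  proof -
    have "(\<Sum>m\<in>S. \<Sum>i\<in>X. \<Sum>j\<in>Y. norm (c m i j x)) = norm (complex_of_real (\<Sum>m\<in>S. \<Sum>i\<in>X. \<Sum>j\<in>Y. norm (c m i j x)))"
      unfolding norm_of_real by (intro abs_of_nonneg[symmetric] sum_nonneg norm_ge_zero)
    then show ?thesis using B0[OF that] by (simp add: of_real_sum)
  qed
  define J where "J = (LINT x|config_measure ?V. norm (G ?V x))"
  show ?thesis unfolding radon2_def
  proof (intro conjI allI impI exI)
    fix u v :: "spacetime \<times> spacetime \<Rightarrow> complex"
    assume uv: "continuous_on UNIV u" "continuous_on UNIV v"
    have "mixed_kernel X Y S f p \<phi> \<psi> (\<lambda>z. u z + v z) x =
        mixed_kernel X Y S f p \<phi> \<psi> u x + mixed_kernel X Y S f p \<phi> \<psi> v x" for x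
      unfolding kernel_c by (simp add: distrib_left sum.distrib)
    then show "(LINT x|config_measure ?V. G ?V x * mixed_kernel X Y S f p \<phi> \<psi> (\<lambda>z. u z + v z) x) =
       (LINT x|config_measure ?V. G ?V x * mixed_kernel X Y S f p \<phi> \<psi> u x) +
       (LINT x|config_measure ?V. G ?V x * mixed_kernel X Y S f p \<phi> \<psi> v x)"
      by (simp add: distrib_left int uv)
  next
    fix a :: complex and u :: "spacetime \<times> spacetime \<Rightarrow> complex"
    have "G ?V x * mixed_kernel X Y S f p \<phi> \<psi> (\<lambda>z. a * u z) x = a * (G ?V x * mixed_kernel X Y S f p \<phi> \<psi> u x)" for x
      unfolding kernel_c by (simp add: sum_distrib_left mult_ac)
    then show "(LINT x|config_measure ?V. G ?V x * mixed_kernel X Y S f p \<phi> \<psi> (\<lambda>z. a * u z) x) =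
       a * (LINT x|config_measure ?V. G ?V x * mixed_kernel X Y S f p \<phi> \<psi> u x)"
      by (simp only: integral_mult_right_zero)
  next
    show "compact (K \<times> K)" by (intro compact_Times compact_K)
  next
    fix u :: "spacetime \<times> spacetime \<Rightarrow> complex" and B
    assume u: "continuous_on UNIV u" and B: "\<forall>z\<in>K \<times> K. norm (u z) \<le> B"
    obtain z0 where "z0 \<in> K" using K_nonempty by blast
    then have "norm (u (z0, z0)) \<le> B" using B by auto
    then have B_nonneg: "B \<ge> 0" using norm_ge_zero order_trans by blast
    have le: "norm (mixed_kernel X Y S f p \<phi> \<psi> u x) \<le> \<bar>B0\<bar> * B" if x: "\<forall>i\<in>?V. x i \<in> K" for x
    proof -
      have "norm (mixed_kernel X Y S f p \<phi> \<psi> u x) \<le> (\<Sum>m\<in>S. \<Sum>i\<in>X. \<Sum>j\<in>Y. norm (c m i j x) * B)"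
        unfolding kernel_c
        by (intro sum_norm_le) (use B x in \<open>auto simp: norm_mult intro!: mult_left_mono\<close>)
      also have "\<dots> = (\<Sum>m\<in>S. \<Sum>i\<in>X. \<Sum>j\<in>Y. norm (c m i j x)) * B"
        by (simp add: sum_distrib_right)
      also have "\<dots> \<le> \<bar>B0\<bar> * B" using B0'[OF x] B_nonneg by (rule mult_right_mono)
      finally show ?thesis .
    qed
    have "norm (LINT x|config_measure ?V. G ?V x * mixed_kernel X Y S f p \<phi> \<psi> u x)
        \<le> (LINT x|config_measure ?V. norm (G ?V x * mixed_kernel X Y S f p \<phi> \<psi> u x))"
      by (rule integral_norm_bound)
    also have "\<dots> \<le> (LINT x|config_measure ?V. norm (complex_of_real (\<bar>B0\<bar> * B) * G ?V x))"
      by (intro integral_mono integrable_norm int u norm_G_mult_le finV le integrable_mult_right integrable_G) auto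
    also have "\<dots> = (\<bar>B0\<bar> * J) * B"
      using B_nonneg by (simp add: J_def norm_mult mult_ac del: of_real_mult)
    finally show "norm (LINT x|config_measure ?V. G ?V x * mixed_kernel X Y S f p \<phi> \<psi> u x) \<le> (\<bar>B0\<bar> * J) * B" .
  qed
qed

lemma pderiv_sum: "pderiv (\<Sum>a\<in>A. q a) = (\<Sum>a\<in>A. pderiv (q a))"
  by (induction A rule: infinite_finite_induct) (simp_all add: pderiv_add)

text \<open>The product rule at parameter value 0. The \<open>of_bool\<close> in the exponent keeps
  the differentiated factor inside the product, matching the form of
  \<open>mixed_kernel\<close>.\<close>

lemma poly_pderiv_prod_linear:
  fixes a b :: "nat \<Rightarrow> complex"
  assumes "finite X"
  shows "poly (pderiv (\<Prod>i\<in>X. [:a i, b i:] ^ p i)) 0 =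
     (\<Sum>i\<in>X. b i * (of_nat (p i) * (\<Prod>l\<in>X. a l ^ (p l - of_bool (l = i)))))"
proof -
  have "poly (prod (\<lambda>i. [:a i, b i:] ^ p i) (X - {i}) * pderiv ([:a i, b i:] ^ p i)) 0 =
      b i * (of_nat (p i) * (\<Prod>l\<in>X. a l ^ (p l - of_bool (l = i))))" if "i \<in> X" for i
  proof -
    have "(\<Prod>l\<in>X. a l ^ (p l - of_bool (l = i))) = a i ^ (p i - 1) * (\<Prod>l\<in>X - {i}. a l ^ (p l - of_bool (l = i)))"
      using prod.remove[OF assms that, of "\<lambda>l. a l ^ (p l - of_bool (l = i))"] by simp
    moreover have "(\<Prod>l\<in>X - {i}. a l ^ (p l - of_bool (l = i))) = (\<Prod>l\<in>X - {i}. a l ^ p l)"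
      by (intro prod.cong) auto
    ultimately show ?thesis by (simp add: pderiv_power poly_prod pderiv_pCons mult_ac)
  qed
  then show ?thesis by (simp add: pderiv_prod poly_sum)
qed

text \<open>Along \<open>\<phi> + s h\<close>, \<open>\<psi> + t k\<close> the integrand is a polynomial in \<open>s\<close> and in \<open>t\<close>, so no
  differentiation under the integral sign is needed.\<close>

lemma mixed_deriv_polynomial_functional:
  assumes fin: "finite X" "finite Y"
    and f: "\<And>m. m \<in> S \<Longrightarrow> tame (X \<union> Y) K (f m)"
    and \<phi>: "continuous_on UNIV \<phi>" and \<psi>: "continuous_on UNIV \<psi>"
    and F: "\<And>\<phi> \<psi>. continuous_on UNIV \<phi> \<Longrightarrow> continuous_on UNIV \<psi> \<Longrightarrow> F \<phi> \<psi> = polynomial_functional X Y S f p \<phi> \<psi>"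
  shows "mixed_deriv F \<phi> \<psi>
     (\<lambda>u. LINT x|config_measure (X \<union> Y). G (X \<union> Y) x * mixed_kernel X Y S f p \<phi> \<psi> u x)"
  unfolding mixed_deriv_def
proof (intro conjI ballI)
  let ?V = "X \<union> Y"
  show "radon2 (\<lambda>u. LINT x|config_measure (X \<union> Y). G (X \<union> Y) x * mixed_kernel X Y S f p \<phi> \<psi> u x)"
    by (rule radon2_mixed_kernel[OF fin f \<phi> \<psi>])
  fix h k assume "h \<in> configs" "k \<in> configs"
  then have h: "continuous_on UNIV h" and k: "continuous_on UNIV k" by (auto intro: configs_continuous)
  have finV: "finite ?V" using fin by simp
  define A where "A m x = (\<Prod>i\<in>X. [:complex_of_real (\<phi> (x i)), complex_of_real (h (x i)):] ^ p m i)" for m x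
  define B where "B m x = (\<Prod>i\<in>Y. [:complex_of_real (\<psi> (x i)), complex_of_real (k (x i)):] ^ p m i)" for m x
  have cc: "tame ?V K (\<lambda>x. complex_of_real (\<theta> (x i)))" if "continuous_on UNIV \<theta>" "i \<in> ?V" for \<theta> :: "spacetime \<Rightarrow> real" and i
    using that by (intro tame_component[of "\<lambda>z. complex_of_real (\<theta> z)"] compact_K continuous_on_of_real)
  have A: "tame_poly ?V K (A m)" for m
    unfolding A_def[abs_def] by (intro tame_poly_prod tame_poly_power tame_poly_linear cc \<phi> h) auto
  have B: "tame_poly ?V K (B m)" for m
    unfolding B_def[abs_def] by (intro tame_poly_prod tame_poly_power tame_poly_linear cc \<psi> k) auto
  have polyA: "poly (A m x) (complex_of_real s) = (\<Prod>i\<in>X. complex_of_real (\<phi> (x i) + s * h (x i)) ^ p m i)" for m x s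
    by (simp add: A_def poly_prod)
  have polyB: "poly (B m x) (complex_of_real s) = (\<Prod>i\<in>Y. complex_of_real (\<psi> (x i) + s * k (x i)) ^ p m i)" for m x s
    by (simp add: B_def poly_prod)
  \<comment> \<open>The t-derivative at 0: \<open>B\<close> is replaced by its linear coefficient,
    while \<open>A\<close> remains a polynomial in s, ready for the outer derivative.\<close>
  define d where "d s = (LINT x|config_measure ?V. G ?V x *
      (\<Sum>m\<in>S. f m x * poly (A m x) (complex_of_real s) * poly (pderiv (B m x)) 0))" for s
  show "\<exists>d. (\<forall>s. ((\<lambda>t. F (\<lambda>x. \<phi> x + s * h x) (\<lambda>y. \<psi> y + t * k y)) has_vector_derivative d s) (at 0)) \<and>
        (d has_vector_derivative (LINT x|config_measure ?V. G ?V x *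
           mixed_kernel X Y S f p \<phi> \<psi> (\<lambda>(x, y). complex_of_real (h x * k y)) x)) (at 0)"
  proof (intro exI[of _ d] conjI allI)
    fix s
    let ?Q = "\<lambda>x. \<Sum>m\<in>S. smult (f m x * (\<Prod>i\<in>X. complex_of_real (\<phi> (x i) + s * h (x i)) ^ p m i)) (B m x)"
    have Q: "tame_poly ?V K ?Q"
      by (intro tame_poly_sum tame_poly_smult tame_mult f B tame_field_prod continuous_intros \<phi> h) auto
    have "F (\<lambda>x. \<phi> x + s * h x) (\<lambda>y. \<psi> y + t * k y) =
        (LINT x|config_measure ?V. G ?V x * poly (?Q x) (complex_of_real t))" for t
      by (subst F) (auto intro!: continuous_intros \<phi> h \<psi> k simp: polynomial_functional_def poly_sum polyB)
    moreover have "d s = (LINT x|config_measure ?V. G ?V x * poly (pderiv (?Q x)) 0)"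
      unfolding d_def polyA by (simp add: pderiv_sum pderiv_smult poly_sum)
    ultimately show "((\<lambda>t. F (\<lambda>x. \<phi> x + s * h x) (\<lambda>y. \<psi> y + t * k y)) has_vector_derivative d s) (at 0)"
      using has_vector_derivative_integral_tame_poly[OF finV Q] by simp
  next
    let ?R = "\<lambda>x. \<Sum>m\<in>S. smult (f m x * poly (pderiv (B m x)) 0) (A m x)"
    have "tame ?V K (\<lambda>x. poly (pderiv (B m x)) 0)" for m
      using B by (simp add: poly_0_coeff_0 coeff_pderiv tame_poly_def)
    then have R: "tame_poly ?V K ?R"
      by (intro tame_poly_sum tame_poly_smult tame_mult f A) auto
    have "d = (\<lambda>s. LINT x|config_measure ?V. G ?V x * poly (?R x) (complex_of_real s))"
      unfolding d_def by (simp add: poly_sum mult_ac)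
    moreover have "mixed_kernel X Y S f p \<phi> \<psi> (\<lambda>(x, y). complex_of_real (h x * k y)) x = poly (pderiv (?R x)) 0" for x
    proof -
      have "poly (pderiv (?R x)) 0 = (\<Sum>m\<in>S. f m x * (poly (pderiv (A m x)) 0 * poly (pderiv (B m x)) 0))"
        by (simp add: pderiv_sum pderiv_smult poly_sum mult_ac)
      also have "\<dots> = mixed_kernel X Y S f p \<phi> \<psi> (\<lambda>(x, y). complex_of_real (h x * k y)) x"
        unfolding A_def B_def poly_pderiv_prod_linear[OF fin(1)] poly_pderiv_prod_linear[OF fin(2)] mixed_kernel_def
        by (simp add: sum_product mult_ac)
      finally show ?thesis by simp
    qed
    ultimately show "(d has_vector_derivative (LINT x|config_measure ?V. G ?V x *
           mixed_kernel X Y S f p \<phi> \<psi> (\<lambda>(x, y). complex_of_real (h x * k y)) x)) (at 0)"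
      using has_vector_derivative_integral_tame_poly[OF finV R] by simp
  qed
qed

text \<open>\<open>F\<close> is prescribed at continuous fields only. All variations of such fields
  by configurations are continuous, and the result of an earlier \<open>Gamma\<close> is known just
  there, so this form can be iterated.\<close>

lemma Gamma_polynomial_functional:
  assumes "finite X" "finite Y"
    and "\<And>m. m \<in> S \<Longrightarrow> tame (X \<union> Y) K (f m)"
    and "continuous_on UNIV \<phi>" "continuous_on UNIV \<psi>"
    and "\<And>\<phi> \<psi>. continuous_on UNIV \<phi> \<Longrightarrow> continuous_on UNIV \<psi> \<Longrightarrow> F \<phi> \<psi> = polynomial_functional X Y S f p \<phi> \<psi>"
    and "continuous_on UNIV D"
  shows "Gamma D F \<phi> \<psi> =
     (LINT x|config_measure (X \<union> Y). G (X \<union> Y) x * mixed_kernel X Y S f p \<phi> \<psi> (\<lambda>(x, y). D (x - y)) x)"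
  by (rule Gamma_eq[OF mixed_deriv_polynomial_functional[OF assms(1-6)] assms(7)])

end

section \<open>Wick contractions\<close>

type_synonym edge = "nat \<times> nat"

definition edges :: "nat set \<Rightarrow> edge set" where
  "edges V = {(i, j). i \<in> V \<and> j \<in> V \<and> i < j}"

text \<open>A pair is stored once, smaller vertex first, whichever factor that vertex belongs to. A
  line between the factors may thus point either way, and its propagator must be reflected
  accordingly.\<close>

definition cross :: "nat set \<Rightarrow> nat set \<Rightarrow> edge set" where
  "cross X Y = {(i, j). i < j \<and> (i \<in> X \<and> j \<in> Y \<or> i \<in> Y \<and> j \<in> X)}"

text \<open>Multiplicities vanish outside the edge set, so that those on a disjoint union of edge sets
  are the pointwise sums of those on the parts.\<close>

definition mults :: "nat \<Rightarrow> edge set \<Rightarrow> (edge \<Rightarrow> nat) set" where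
  "mults n E = {m. (\<forall>e\<in>E. m e \<le> n) \<and> (\<forall>e. e \<notin> E \<longrightarrow> m e = 0)}"

definition degr :: "edge set \<Rightarrow> (edge \<Rightarrow> nat) \<Rightarrow> nat \<Rightarrow> nat" where
  "degr E m i = (\<Sum>e\<in>E. if fst e = i \<or> snd e = i then m e else 0)"

text \<open>The subtraction truncates, but only after a factor \<open>0\<close> has occurred.\<close>

definition falling :: "nat \<Rightarrow> nat \<Rightarrow> complex" where
  "falling n d = (\<Prod>k<d. of_nat (n - k))"

text \<open>The factorials stem from the exponentials of the single pairs, the falling factorials
  from differentiating t^n as often as lines end at the vertex.\<close>

definition wick_coeff :: "nat \<Rightarrow> nat set \<Rightarrow> edge set \<Rightarrow> (edge \<Rightarrow> complex) \<Rightarrow> (edge \<Rightarrow> nat) \<Rightarrow> complex" where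
  "wick_coeff n V E w m = (\<Prod>e\<in>E. w e ^ m e / fact (m e)) * (\<Prod>i\<in>V. falling n (degr E m i))"

text \<open>This is \<open>exp (\<Sum>\<^bsub>i<j\<^esub> w\<^bsub>ij\<^esub> \<partial>\<^sub>i \<partial>\<^sub>j)\<close> applied to \<open>\<Prod>\<^sub>i t\<^sub>i\<^sup>n\<close>, expanded over the multiplicities of the
  contractions. Multiplicities above \<open>n\<close> would contribute \<open>0\<close>.\<close>

definition wick :: "nat \<Rightarrow> nat set \<Rightarrow> (edge \<Rightarrow> complex) \<Rightarrow> (nat \<Rightarrow> complex) \<Rightarrow> complex" where
  "wick n V w t = (\<Sum>m\<in>mults n (edges V). wick_coeff n V (edges V) w m * (\<Prod>i\<in>V. t i ^ (n - degr (edges V) m i)))"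

lemma finite_edges: "finite V \<Longrightarrow> finite (edges V)"
  by (rule finite_subset[of _ "V \<times> V"]) (auto simp: edges_def)

lemma edges_Un: "edges (X \<union> Y) = edges X \<union> edges Y \<union> cross X Y"
  by (auto simp: edges_def cross_def)

lemma cross_disjoint: "X \<inter> Y = {} \<Longrightarrow> (edges X \<union> edges Y) \<inter> cross X Y = {}"
  by (auto simp: edges_def cross_def)

lemma finite_mults:
  assumes "finite E"
  shows "finite (mults n E)"
proof -
  have "mults n E = {m. \<forall>e. (e \<in> E \<longrightarrow> m e \<in> {..n}) \<and> (e \<notin> E \<longrightarrow> m e = 0)}"
    by (auto simp: mults_def)
  then show ?thesis using finite_set_of_finite_funs[OF assms, of "{..n}" 0] by simp
qed

lemma falling_Suc: "falling n (Suc d) = falling n d * of_nat (n - d)"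
  by (simp add: falling_def)

lemma falling_eq_0: "n < d \<Longrightarrow> falling n d = 0"
  by (auto simp: falling_def intro!: bexI[of _ n])

lemma degr_ge:
  assumes "finite E" "e \<in> E" "fst e = i \<or> snd e = i"
  shows "m e \<le> degr E m i"
  using member_le_sum[OF assms(2), of "\<lambda>e. if fst e = i \<or> snd e = i then m e else 0"] assms
  by (auto simp: degr_def)

lemma degr_fun_upd:
  assumes "finite E" "c \<in> E"
  shows "degr E (m(c := Suc (m c))) i = degr E m i + of_bool (fst c = i \<or> snd c = i)"
proof -
  have upd: "(\<Sum>e\<in>E - {c}. if fst e = i \<or> snd e = i then (m(c := Suc (m c))) e else 0) =
      (\<Sum>e\<in>E - {c}. if fst e = i \<or> snd e = i then m e else 0)"
    by (intro sum.cong) auto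
  show ?thesis
    unfolding degr_def sum.remove[OF assms, of "\<lambda>e. if fst e = i \<or> snd e = i then (m(c := Suc (m c))) e else 0"]
      sum.remove[OF assms, of "\<lambda>e. if fst e = i \<or> snd e = i then m e else 0"] upd
    by simp
qed

lemma wick_coeff_eq_0:
  assumes "finite V" "e \<in> edges V" "n < m e"
  shows "wick_coeff n V (edges V) w m = 0"
proof -
  have "m e \<le> degr (edges V) m (fst e)"
    using degr_ge[OF finite_edges[OF assms(1)] assms(2)] by blast
  then have "falling n (degr (edges V) m (fst e)) = 0"
    using assms(3) by (intro falling_eq_0) simp
  moreover have "fst e \<in> V" using assms(2) by (auto simp: edges_def)
  ultimately show ?thesis using assms(1) by (auto simp: wick_coeff_def)
qed

text \<open>One more line between a and b divides the coefficient by the new multiplicity and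
  lengthens the falling factorials at both ends by one factor: the effect of the differential
  operator for this pair on a single term.\<close>

lemma wick_coeff_fun_upd:
  assumes V: "finite V" and c: "(a, b) \<in> edges V"
  shows "wick_coeff n V (edges V) w m * w (a, b) * of_nat (n - degr (edges V) m a) * of_nat (n - degr (edges V) m b)
     = of_nat (Suc (m (a, b))) * wick_coeff n V (edges V) w (m((a, b) := Suc (m (a, b))))"
proof -
  let ?c = "(a, b)" and ?E = "edges V"
  let ?m = "m(?c := Suc (m ?c))"
  have ab: "a \<in> V" "b \<in> V" "a \<noteq> b" using c by (auto simp: edges_def)
  have finE: "finite ?E" using V by (rule finite_edges)
  have "(\<Prod>e\<in>?E. w e ^ ?m e / fact (?m e)) = w ?c ^ Suc (m ?c) / fact (Suc (m ?c)) * (\<Prod>e\<in>?E - {?c}. w e ^ ?m e / fact (?m e))"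
    by (subst prod.remove[OF finE c]) simp
  also have "(\<Prod>e\<in>?E - {?c}. w e ^ ?m e / fact (?m e)) = (\<Prod>e\<in>?E - {?c}. w e ^ m e / fact (m e))"
    by (intro prod.cong) auto
  finally have 1: "of_nat (Suc (m ?c)) * (\<Prod>e\<in>?E. w e ^ ?m e / fact (?m e)) = w ?c * (\<Prod>e\<in>?E. w e ^ m e / fact (m e))"
    by (subst (2) prod.remove[OF finE c]) (simp add: field_simps del: of_nat_Suc)
  have "(\<Prod>i\<in>V. falling n (degr ?E ?m i)) = (\<Prod>i\<in>V. falling n (degr ?E m i) *
      (if i = a \<or> i = b then of_nat (n - degr ?E m i) else 1))"
    by (intro prod.cong refl) (auto simp: degr_fun_upd[OF finE c] falling_Suc)
  also have "\<dots> = (\<Prod>i\<in>V. falling n (degr ?E m i)) * (\<Prod>i\<in>{a, b}. of_nat (n - degr ?E m i))"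
  proof -
    have "(\<Prod>i\<in>V. if i = a \<or> i = b then of_nat (n - degr ?E m i) else (1::complex)) = (\<Prod>i\<in>{a, b}. of_nat (n - degr ?E m i))"
      using V ab by (intro prod.mono_neutral_cong_right) auto
    then show ?thesis by (simp only: prod.distrib)
  qed
  finally have 2: "(\<Prod>i\<in>V. falling n (degr ?E ?m i)) = (\<Prod>i\<in>V. falling n (degr ?E m i)) * (of_nat (n - degr ?E m a) * of_nat (n - degr ?E m b))"
    using ab by simp
  have "of_nat (Suc (m ?c)) * wick_coeff n V ?E w ?m
      = (of_nat (Suc (m ?c)) * (\<Prod>e\<in>?E. w e ^ ?m e / fact (?m e))) * (\<Prod>i\<in>V. falling n (degr ?E ?m i))"
    unfolding wick_coeff_def by (simp only: mult.assoc)
  also have "\<dots> = wick_coeff n V ?E w m * w ?c * of_nat (n - degr ?E m a) * of_nat (n - degr ?E m b)"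
    unfolding 1 2 wick_coeff_def by (simp only: mult_ac)
  finally show ?thesis by simp
qed

section \<open>Contractions sorted by the number of lines between two factors\<close>

definition level :: "nat \<Rightarrow> edge set \<Rightarrow> edge set \<Rightarrow> nat \<Rightarrow> (edge \<Rightarrow> nat) set" where
  "level n E C r = {m \<in> mults n E. sum m C = r}"

text \<open>Double counting of contractions with one marked line. A contraction m of order r + 1
  arises by adding a line at c with weight m c, and these weights sum to r + 1. Raising a
  multiplicity from n leaves \<open>mults\<close>, but there \<open>\<tau>\<close> vanishes.\<close>

lemma sum_level_Suc:
  fixes \<tau> :: "(edge \<Rightarrow> nat) \<Rightarrow> complex"
  assumes E: "finite E" and C: "C \<subseteq> E"
    and \<tau>: "\<And>m e. e \<in> E \<Longrightarrow> n < m e \<Longrightarrow> \<tau> m = 0"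
  shows "(\<Sum>m\<in>level n E C r. \<Sum>c\<in>C. of_nat (Suc (m c)) * \<tau> (m(c := Suc (m c))))
     = of_nat (Suc r) * (\<Sum>m\<in>level n E C (Suc r). \<tau> m)"
proof -
  have finC: "finite C" using C E by (rule finite_subset)
  have finL: "finite (level n E C r)" for r
    unfolding level_def using finite_mults[OF E] by simp
  have sum_upd: "sum (m(c := k)) C = k + sum m (C - {c})" if "c \<in> C" for m :: "edge \<Rightarrow> nat" and c k
  proof -
    have "sum (m(c := k)) (C - {c}) = sum m (C - {c})" by (intro sum.cong) auto
    then show ?thesis using sum.remove[OF finC that, of "m(c := k)"] by simp
  qed
  have sum_rem: "sum m C = m c + sum m (C - {c})" if "c \<in> C" for m :: "edge \<Rightarrow> nat" and c
    using sum.remove[OF finC that, of m] by simp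
  have up: "m(c := Suc (m c)) \<in> level n E C (Suc r)" if "m \<in> level n E C r" "c \<in> C" "m c < n" for m c
    using that C sum_upd[OF that(2), of m "Suc (m c)"] sum_rem[OF that(2), of m]
    by (auto simp: level_def mults_def)
  have down: "m(c := m c - Suc 0) \<in> level n E C r" if "m \<in> level n E C (Suc r)" "c \<in> C" "0 < m c" for m c
    using that C sum_upd[OF that(2), of m "m c - Suc 0"] sum_rem[OF that(2), of m]
    by (auto simp: level_def mults_def intro: le_trans[OF diff_le_self])
  have below: "m c \<le> n" if "m \<in> level n E C (Suc r)" "c \<in> C" for m c
    using that C by (auto simp: level_def mults_def)
  have "(\<Sum>m\<in>level n E C r. \<Sum>c\<in>C. of_nat (Suc (m c)) * \<tau> (m(c := Suc (m c))))
      = (\<Sum>(m, c)\<in>level n E C r \<times> C. of_nat (Suc (m c)) * \<tau> (m(c := Suc (m c))))"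
    by (simp add: sum.cartesian_product)
  also have "\<dots> = (\<Sum>(m, c)\<in>{(m, c). m \<in> level n E C r \<and> c \<in> C \<and> m c < n}. of_nat (Suc (m c)) * \<tau> (m(c := Suc (m c))))"
  proof (rule sum.mono_neutral_right)
    have vanish: "\<tau> (m(c := Suc (m c))) = 0" if "c \<in> C" "\<not> m c < n" for m c
      using that C by (intro \<tau>[of c]) auto
    show "\<forall>z\<in>level n E C r \<times> C - {(m, c). m \<in> level n E C r \<and> c \<in> C \<and> m c < n}.
        (case z of (m, c) \<Rightarrow> of_nat (Suc (m c)) * \<tau> (m(c := Suc (m c)))) = 0"
    proof (intro ballI)
      fix z assume z: "z \<in> level n E C r \<times> C - {(m, c). m \<in> level n E C r \<and> c \<in> C \<and> m c < n}"
      obtain m c where mc: "z = (m, c)" by (cases z)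
      with z have "\<tau> (m(c := Suc (m c))) = 0" by (intro vanish) auto
      then show "(case z of (m, c) \<Rightarrow> of_nat (Suc (m c)) * \<tau> (m(c := Suc (m c)))) = 0"
        by (simp only: mc prod.case mult_zero_right)
    qed
  qed (use finL finC in auto)
  also have "\<dots> = (\<Sum>(m, c)\<in>{(m, c). m \<in> level n E C (Suc r) \<and> c \<in> C \<and> m c > 0}. of_nat (m c) * \<tau> m)"
    by (rule sum.reindex_bij_witness[where i = "\<lambda>(m, c). (m(c := m c - 1), c)" and j = "\<lambda>(m, c). (m(c := Suc (m c)), c)"])
       (auto intro: up down dest: below)
  also have "\<dots> = (\<Sum>(m, c)\<in>level n E C (Suc r) \<times> C. of_nat (m c) * \<tau> m)"
    using finL finC by (intro sum.mono_neutral_left) auto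
  also have "\<dots> = (\<Sum>m\<in>level n E C (Suc r). of_nat (sum m C) * \<tau> m)"
    by (simp add: sum.cartesian_product[symmetric] sum_distrib_right)
  also have "\<dots> = of_nat (Suc r) * (\<Sum>m\<in>level n E C (Suc r). \<tau> m)"
    by (simp add: level_def sum_distrib_left)
  finally show ?thesis .
qed

lemma sum_mults_eq_sum_level:
  fixes \<tau> :: "(edge \<Rightarrow> nat) \<Rightarrow> complex"
  assumes "finite E" "C \<subseteq> E"
  shows "(\<Sum>m\<in>mults n E. \<tau> m) = (\<Sum>r\<le>n * card C. \<Sum>m\<in>level n E C r. \<tau> m)"
proof -
  have "sum m C \<le> n * card C" if "m \<in> mults n E" for m
    using sum_bounded_above[of C m n] that assms(2) by (auto simp: mults_def mult.commute)
  then show ?thesis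
    unfolding level_def using finite_mults[OF assms(1)] by (intro sum.group[symmetric]) auto
qed

text \<open>Each cross pair carries at most n lines; this is what terminates the series in
  \<open>exp_Gamma\<close>.\<close>

lemma level_empty:
  assumes "C \<subseteq> E" "n * card C < r"
  shows "level n E C r = {}"
proof -
  have "sum m C \<le> n * card C" if "m \<in> mults n E" for m
    using sum_bounded_above[of C m n] that assms(1) by (auto simp: mults_def mult.commute)
  then show ?thesis using assms(2) by (force simp: level_def)
qed

text \<open>Without lines between \<open>X\<close> and \<open>Y\<close> a contraction is a pair of
  internal ones, and factorials, degrees and powers separate. The plain product is therefore the
  part of order 0.\<close>

lemma wick_mult:
  assumes X: "finite X" and Y: "finite Y" and XY: "X \<inter> Y = {}"
  shows "wick n X w t * wick n Y w t =
     (\<Sum>m\<in>level n (edges (X \<union> Y)) (cross X Y) 0. wick_coeff n (X \<union> Y) (edges (X \<union> Y)) w m *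
        (\<Prod>i\<in>X \<union> Y. t i ^ (n - degr (edges (X \<union> Y)) m i)))"
proof -
  let ?EX = "edges X" and ?EY = "edges Y" and ?C = "cross X Y" and ?E = "edges (X \<union> Y)"
  have fin: "finite ?EX" "finite ?EY" "finite ?E" using X Y by (auto intro: finite_edges)
  have finC: "finite ?C" using fin(3) by (simp add: edges_Un)
  have disj: "?EX \<inter> ?EY = {}" "(?EX \<union> ?EY) \<inter> ?C = {}" 
    using XY cross_disjoint[OF XY] by (auto simp: edges_def)
  have level0: "level n ?E ?C 0 = mults n (?EX \<union> ?EY)"
  proof (intro set_eqI)
    fix m
    have "m \<in> level n ?E ?C 0 \<longleftrightarrow> (\<forall>e\<in>?EX \<union> ?EY. m e \<le> n) \<and> (\<forall>e\<in>?C. m e = 0) \<and>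
        (\<forall>e. e \<notin> ?EX \<union> ?EY \<union> ?C \<longrightarrow> m e = 0)"
      unfolding level_def mults_def edges_Un using finC by auto
    also have "\<dots> \<longleftrightarrow> m \<in> mults n (?EX \<union> ?EY)"
      unfolding mults_def mem_Collect_eq using disj(2) by blast
    finally show "m \<in> level n ?E ?C 0 \<longleftrightarrow> m \<in> mults n (?EX \<union> ?EY)" .
  qed
  have term_mult: "wick_coeff n (X \<union> Y) ?E w (\<lambda>e. m1 e + m2 e) * (\<Prod>i\<in>X \<union> Y. t i ^ (n - degr ?E (\<lambda>e. m1 e + m2 e) i))
     = (wick_coeff n X ?EX w m1 * (\<Prod>i\<in>X. t i ^ (n - degr ?EX m1 i))) *
       (wick_coeff n Y ?EY w m2 * (\<Prod>i\<in>Y. t i ^ (n - degr ?EY m2 i)))"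
    if m: "m1 \<in> mults n ?EX" "m2 \<in> mults n ?EY" for m1 m2
  proof -
    let ?m = "\<lambda>e. m1 e + m2 e"
    have zero: "e \<notin> ?EX \<Longrightarrow> m1 e = 0" "e \<notin> ?EY \<Longrightarrow> m2 e = 0" for e
      using m unfolding mults_def by blast+
    have mC: "?m e = 0" if "e \<in> ?C" for e using zero[of e] that disj by auto
    have mX: "?m e = m1 e" if "e \<in> ?EX" for e using zero[of e] that disj by auto
    have mY: "?m e = m2 e" if "e \<in> ?EY" for e using zero[of e] that disj by auto
    have dX: "degr ?E ?m i = degr ?EX m1 i" if "i \<in> X" for i
      unfolding degr_def
    proof (rule sum.mono_neutral_cong_right)
      show "\<forall>e\<in>?E - ?EX. (if fst e = i \<or> snd e = i then m1 e + m2 e else 0) = 0"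
        using mC XY that by (auto simp: edges_Un) (auto simp: edges_def mults_def)
    qed (use fin mX in \<open>auto simp: edges_Un\<close>)
    have dY: "degr ?E ?m i = degr ?EY m2 i" if "i \<in> Y" for i
      unfolding degr_def
    proof (rule sum.mono_neutral_cong_right)
      show "\<forall>e\<in>?E - ?EY. (if fst e = i \<or> snd e = i then m1 e + m2 e else 0) = 0"
        using mC XY that by (auto simp: edges_Un) (auto simp: edges_def mults_def)
    qed (use fin mY in \<open>auto simp: edges_Un\<close>)
    have "(\<Prod>e\<in>?E. w e ^ ?m e / fact (?m e)) = (\<Prod>e\<in>?EX \<union> ?EY. w e ^ ?m e / fact (?m e))"
      using fin mC by (intro prod.mono_neutral_right) (auto simp: edges_Un)
    also have "\<dots> = (\<Prod>e\<in>?EX. w e ^ ?m e / fact (?m e)) * (\<Prod>e\<in>?EY. w e ^ ?m e / fact (?m e))"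
      using fin disj by (intro prod.union_disjoint) auto
    also have "\<dots> = (\<Prod>e\<in>?EX. w e ^ m1 e / fact (m1 e)) * (\<Prod>e\<in>?EY. w e ^ m2 e / fact (m2 e))"
      using mX mY by simp
    finally show ?thesis
      unfolding wick_coeff_def
      by (simp add: prod.union_disjoint[OF X Y XY] dX dY mult_ac)
  qed
  have "wick n X w t * wick n Y w t = (\<Sum>(m1, m2)\<in>mults n ?EX \<times> mults n ?EY.
      (wick_coeff n X ?EX w m1 * (\<Prod>i\<in>X. t i ^ (n - degr ?EX m1 i))) *
       (wick_coeff n Y ?EY w m2 * (\<Prod>i\<in>Y. t i ^ (n - degr ?EY m2 i))))"
    unfolding wick_def by (simp add: sum_product sum.cartesian_product)
  also have "\<dots> = (\<Sum>m\<in>mults n (?EX \<union> ?EY). wick_coeff n (X \<union> Y) ?E w m * (\<Prod>i\<in>X \<union> Y. t i ^ (n - degr ?E m i)))"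
  proof (rule sum.reindex_bij_witness[where j = "\<lambda>(m1, m2) e. m1 e + m2 e"
        and i = "\<lambda>m. (\<lambda>e. if e \<in> ?EX then m e else 0, \<lambda>e. if e \<in> ?EY then m e else 0)"])
    fix a assume a: "a \<in> mults n ?EX \<times> mults n ?EY"
    obtain m1 m2 where [simp]: "a = (m1, m2)" by (cases a)
    have zero: "e \<notin> ?EX \<Longrightarrow> m1 e = 0" "e \<notin> ?EY \<Longrightarrow> m2 e = 0" for e
      using a unfolding mults_def \<open>a = (m1, m2)\<close> by blast+
    have notboth: "e \<in> ?EX \<Longrightarrow> e \<notin> ?EY" "e \<in> ?EY \<Longrightarrow> e \<notin> ?EX" for e using disj by auto
    show "(\<lambda>m. (\<lambda>e. if e \<in> ?EX then m e else 0, \<lambda>e. if e \<in> ?EY then m e else 0))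
        ((\<lambda>(m1, m2) e. m1 e + m2 e) a) = a"
      using zero notboth by (auto simp: fun_eq_iff)
    show "(\<lambda>(m1, m2) e. m1 e + m2 e) a \<in> mults n (?EX \<union> ?EY)"
      using a zero notboth by (auto simp: mults_def)
    show "wick_coeff n (X \<union> Y) ?E w ((\<lambda>(m1, m2) e. m1 e + m2 e) a) *
         (\<Prod>i\<in>X \<union> Y. t i ^ (n - degr ?E ((\<lambda>(m1, m2) e. m1 e + m2 e) a) i)) =
         (case a of (m1, m2) \<Rightarrow> (wick_coeff n X ?EX w m1 * (\<Prod>i\<in>X. t i ^ (n - degr ?EX m1 i))) *
       (wick_coeff n Y ?EY w m2 * (\<Prod>i\<in>Y. t i ^ (n - degr ?EY m2 i))))"
      using a term_mult by simp
  next
    fix m assume m: "m \<in> mults n (?EX \<union> ?EY)"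
    show "(\<lambda>e. if e \<in> ?EX then m e else 0, \<lambda>e. if e \<in> ?EY then m e else 0) \<in> mults n ?EX \<times> mults n ?EY"
      using m by (auto simp: mults_def)
    have "m e = 0" if "e \<notin> ?EX" "e \<notin> ?EY" for e using m that unfolding mults_def by blast
    then show "(\<lambda>(m1, m2) e. m1 e + m2 e) (\<lambda>e. if e \<in> ?EX then m e else 0, \<lambda>e. if e \<in> ?EY then m e else 0) = m"
      using disj by (auto simp: fun_eq_iff)
  qed
  finally show ?thesis by (simp only: level0)
qed

section \<open>Products of Wick functionals\<close>

lemma wick_cong:
  assumes "\<And>e. e \<in> edges V \<Longrightarrow> w e = w' e" "\<And>i. i \<in> V \<Longrightarrow> t i = t' i"
  shows "wick n V w t = wick n V w' t'"
  unfolding wick_def wick_coeff_def using assms by (intro sum.cong arg_cong2[where f = "(*)"] prod.cong refl) auto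

abbreviation weight :: "(edge \<Rightarrow> spacetime \<Rightarrow> complex) \<Rightarrow> (nat \<Rightarrow> spacetime) \<Rightarrow> edge \<Rightarrow> complex" where
  "weight P x e \<equiv> P e (x (fst e) - x (snd e))"

context source
begin

definition wick_functional :: "nat \<Rightarrow> nat set \<Rightarrow> (edge \<Rightarrow> spacetime \<Rightarrow> complex) \<Rightarrow> functional" where
  "wick_functional n V P \<phi> =
     (LINT x|config_measure V. G V x * wick n V (weight P x) (\<lambda>i. complex_of_real (\<phi> (x i))))"

lemma tame_wick_coeff:
  assumes "\<And>e. e \<in> edges V \<Longrightarrow> continuous_on UNIV (P e)"
  shows "tame V K (\<lambda>x. wick_coeff n V (edges V) (weight P x) m)"
  unfolding wick_coeff_def divide_inverse
proof (intro tame_mult tame_prod tame_power tame_const)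
  fix e assume e: "e \<in> edges V"
  have "continuous_on UNIV (\<lambda>z. P e (fst z - snd z))"
    by (intro continuous_on_compose2[OF assms[OF e]] continuous_intros) auto
  from tame_pair[OF this compact_K, of "fst e" V "snd e"] e
  show "tame V K (\<lambda>x. weight P x e)" by (auto simp: edges_def)
qed

lemma tame_wick:
  assumes "\<And>e. e \<in> edges V \<Longrightarrow> continuous_on UNIV (P e)" "continuous_on UNIV \<phi>"
  shows "tame V K (\<lambda>x. wick n V (weight P x) (\<lambda>i. complex_of_real (\<phi> (x i))))"
  unfolding wick_def by (intro tame_sum tame_mult tame_wick_coeff tame_field_prod assms) auto

text \<open>The part of order \<open>r\<close> in the contractions between \<open>X\<close> and \<open>Y\<close>.\<close>

definition wick_level :: "nat \<Rightarrow> nat set \<Rightarrow> nat set \<Rightarrow> (edge \<Rightarrow> spacetime \<Rightarrow> complex) \<Rightarrow> complex \<Rightarrow> nat \<Rightarrow> functional2" where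
  "wick_level n X Y P a r = polynomial_functional X Y (level n (edges (X \<union> Y)) (cross X Y) r)
     (\<lambda>m x. a * wick_coeff n (X \<union> Y) (edges (X \<union> Y)) (weight P x) m) (\<lambda>m i. n - degr (edges (X \<union> Y)) m i)"

lemma wick_level_mult: "wick_level n X Y P (a * b) r \<phi> \<psi> = a * wick_level n X Y P b r \<phi> \<psi>"
proof -
  have "G (X \<union> Y) x * (\<Sum>m\<in>S. a * b * A m * B m * C m) = a * (G (X \<union> Y) x * (\<Sum>m\<in>S. b * A m * B m * C m))"
    for x and S :: "(edge \<Rightarrow> nat) set" and A B C :: "(edge \<Rightarrow> nat) \<Rightarrow> complex"
    by (simp add: sum_distrib_left mult_ac)
  then show ?thesis
    unfolding wick_level_def polynomial_functional_def by (simp only: integral_mult_right_zero)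
qed

end

text \<open>On lines between the factors \<open>P\<close> is the propagator \<open>D\<close> of the
  product, read from the vertex in \<open>X\<close> to the vertex in \<open>Y\<close>. For a line
  stored in the opposite direction this reverses the argument.\<close>

locale wick_product = source +
  fixes X Y :: "nat set" and P :: "edge \<Rightarrow> spacetime \<Rightarrow> complex" and D :: "spacetime \<Rightarrow> complex" and n :: nat
  assumes finX: "finite X" and finY: "finite Y" and XY: "X \<inter> Y = {}"
    and cont_P: "\<And>e. e \<in> edges (X \<union> Y) \<Longrightarrow> continuous_on UNIV (P e)"
    and cont_D: "continuous_on UNIV D"
    and P_forward: "\<And>i j z. i \<in> X \<Longrightarrow> j \<in> Y \<Longrightarrow> i < j \<Longrightarrow> P (i, j) z = D z"
    and P_backward: "\<And>i j z. i \<in> Y \<Longrightarrow> j \<in> X \<Longrightarrow> i < j \<Longrightarrow> P (i, j) z = D (- z)"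
begin

text \<open>Contracting i in \<open>X\<close> with j in \<open>Y\<close> adds the line between them,
  with the weight that \<open>P\<close> assigns to it. All such additions together are the double
  count in \<open>sum_level_Suc\<close>.\<close>

lemma mixed_kernel_level:
  fixes \<phi> \<psi> :: "spacetime \<Rightarrow> real"
  shows "mixed_kernel X Y (level n (edges (X \<union> Y)) (cross X Y) r)
     (\<lambda>m x. a * wick_coeff n (X \<union> Y) (edges (X \<union> Y)) (weight P x) m) (\<lambda>m i. n - degr (edges (X \<union> Y)) m i)
     \<phi> \<psi> (\<lambda>(x, y). D (x - y)) x =
   of_nat (Suc r) * (\<Sum>m\<in>level n (edges (X \<union> Y)) (cross X Y) (Suc r).
      a * wick_coeff n (X \<union> Y) (edges (X \<union> Y)) (weight P x) m *
      (\<Prod>i\<in>X. complex_of_real (\<phi> (x i)) ^ (n - degr (edges (X \<union> Y)) m i)) *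
      (\<Prod>j\<in>Y. complex_of_real (\<psi> (x j)) ^ (n - degr (edges (X \<union> Y)) m j)))"
proof -
  let ?V = "X \<union> Y"
  let ?E = "edges ?V" and ?C = "cross X Y"
  have finV: "finite ?V" and finE: "finite ?E" using finX finY finite_edges by auto
  let ?w = "wick_coeff n ?V ?E (weight P x)"
  define \<tau> where "\<tau> m = a * ?w m *
      (\<Prod>i\<in>X. complex_of_real (\<phi> (x i)) ^ (n - degr ?E m i)) *
      (\<Prod>j\<in>Y. complex_of_real (\<psi> (x j)) ^ (n - degr ?E m j))" for m
  have step: "a * ?w m * (\<Sum>i\<in>X. \<Sum>j\<in>Y. D (x i - x j) *
        (of_nat (n - degr ?E m i) * (\<Prod>l\<in>X. complex_of_real (\<phi> (x l)) ^ (n - degr ?E m l - of_bool (l = i)))) *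
        (of_nat (n - degr ?E m j) * (\<Prod>l\<in>Y. complex_of_real (\<psi> (x l)) ^ (n - degr ?E m l - of_bool (l = j)))))
      = (\<Sum>c\<in>?C. of_nat (Suc (m c)) * \<tau> (m(c := Suc (m c))))" (is "?lhs = _") for m
  proof -
    define h where "h i j = a * ?w m * (D (x i - x j) *
        (of_nat (n - degr ?E m i) * (\<Prod>l\<in>X. complex_of_real (\<phi> (x l)) ^ (n - degr ?E m l - of_bool (l = i)))) *
        (of_nat (n - degr ?E m j) * (\<Prod>l\<in>Y. complex_of_real (\<psi> (x l)) ^ (n - degr ?E m l - of_bool (l = j)))))" for i j
    have edge: "h i j = of_nat (Suc (m c)) * \<tau> (m(c := Suc (m c)))"
      if ij: "i \<in> X" "j \<in> Y" and c: "c = (min i j, max i j)" for i j c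
    proof -
      have ne: "i \<noteq> j" using ij XY by auto
      then have cE: "(min i j, max i j) \<in> ?E" using ij by (auto simp: edges_def min_def max_def)
      have wc: "weight P x c = D (x i - x j)"
      proof (cases "i < j")
        case True
        then show ?thesis using ij c by (simp add: P_forward)
      next
        case False
        then have "j < i" using ne by simp
        then show ?thesis using ij c by (simp add: P_backward)
      qed
      have deg: "degr ?E (m(c := Suc (m c))) l = degr ?E m l + of_bool (l = i \<or> l = j)" for l
        unfolding c degr_fun_upd[OF finE cE] using ne by (auto simp: min_def max_def)
      have pX: "(\<Prod>l\<in>X. complex_of_real (\<phi> (x l)) ^ (n - degr ?E m l - of_bool (l = i))) =
          (\<Prod>l\<in>X. complex_of_real (\<phi> (x l)) ^ (n - degr ?E (m(c := Suc (m c))) l))"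
        using ij XY by (intro prod.cong refl arg_cong2[where f = "(^)"]) (auto simp: deg)
      have pY: "(\<Prod>l\<in>Y. complex_of_real (\<psi> (x l)) ^ (n - degr ?E m l - of_bool (l = j))) =
          (\<Prod>l\<in>Y. complex_of_real (\<psi> (x l)) ^ (n - degr ?E (m(c := Suc (m c))) l))"
        using ij XY by (intro prod.cong refl arg_cong2[where f = "(^)"]) (auto simp: deg)
      have upd: "?w m * D (x i - x j) * (of_nat (n - degr ?E m i) * of_nat (n - degr ?E m j))
          = of_nat (Suc (m c)) * ?w (m(c := Suc (m c)))"
      proof -
        have "of_nat (n - degr ?E m (min i j)) * of_nat (n - degr ?E m (max i j)) =
            (of_nat (n - degr ?E m i) * of_nat (n - degr ?E m j) :: complex)"
          by (cases "i < j") (auto simp: min_def max_def)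
        with wick_coeff_fun_upd[OF finV cE, of n "weight P x" m] wc show ?thesis
          unfolding c by (simp only: mult.assoc)
      qed
      have "h i j = a * (?w m * D (x i - x j) * (of_nat (n - degr ?E m i) * of_nat (n - degr ?E m j))) *
          (\<Prod>l\<in>X. complex_of_real (\<phi> (x l)) ^ (n - degr ?E (m(c := Suc (m c))) l)) *
          (\<Prod>l\<in>Y. complex_of_real (\<psi> (x l)) ^ (n - degr ?E (m(c := Suc (m c))) l))"
        unfolding h_def pX pY by (simp only: mult_ac)
      also have "\<dots> = of_nat (Suc (m c)) * \<tau> (m(c := Suc (m c)))"
        unfolding upd \<tau>_def by (simp only: mult_ac)
      finally show ?thesis .
    qed
    have "?lhs = (\<Sum>(i, j)\<in>X \<times> Y. h i j)"
      by (simp only: h_def sum_distrib_left flip: sum.cartesian_product)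
    also have "\<dots> = (\<Sum>c\<in>?C. of_nat (Suc (m c)) * \<tau> (m(c := Suc (m c))))"
    proof (rule sum.reindex_bij_witness[where j = "\<lambda>(i, j). (min i j, max i j)"
          and i = "\<lambda>(i, j). if i \<in> X then (i, j) else (j, i)"])
      fix z assume z: "z \<in> X \<times> Y"
      then obtain i j where ij: "z = (i, j)" "i \<in> X" "j \<in> Y" by auto
      then have "i \<noteq> j" "i \<notin> Y" "j \<notin> X" using XY by auto
      then show "(\<lambda>(i, j). if i \<in> X then (i, j) else (j, i)) ((\<lambda>(i, j). (min i j, max i j)) z) = z"
        "(\<lambda>(i, j). (min i j, max i j)) z \<in> ?C"
        using ij by (auto simp: cross_def min_def max_def)
      show "of_nat (Suc (m ((\<lambda>(i, j). (min i j, max i j)) z))) *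
          \<tau> (m((\<lambda>(i, j). (min i j, max i j)) z := Suc (m ((\<lambda>(i, j). (min i j, max i j)) z)))) = (case z of (i, j) \<Rightarrow> h i j)"
        using edge[OF ij(2,3) refl] unfolding ij(1) prod.case by (rule sym)
    next
      fix c assume "c \<in> ?C"
      then show "(\<lambda>(i, j). (min i j, max i j)) ((\<lambda>(i, j). if i \<in> X then (i, j) else (j, i)) c) = c"
        "(\<lambda>(i, j). if i \<in> X then (i, j) else (j, i)) c \<in> X \<times> Y"
        using XY by (auto simp: cross_def)
    qed
    finally show ?thesis .
  qed
  have "mixed_kernel X Y (level n ?E ?C r) (\<lambda>m x. a * wick_coeff n ?V ?E (weight P x) m)
      (\<lambda>m i. n - degr ?E m i) \<phi> \<psi> (\<lambda>(x, y). D (x - y)) x =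
      (\<Sum>m\<in>level n ?E ?C r. \<Sum>c\<in>?C. of_nat (Suc (m c)) * \<tau> (m(c := Suc (m c))))"
    unfolding mixed_kernel_def prod.case step ..
  also have "\<dots> = of_nat (Suc r) * (\<Sum>m\<in>level n ?E ?C (Suc r). \<tau> m)"
  proof (rule sum_level_Suc[OF finE])
    show "?C \<subseteq> ?E" by (auto simp: edges_Un)
    show "\<tau> m = 0" if "e \<in> ?E" "n < m e" for m e
      using wick_coeff_eq_0[where m = m and e = e, OF finV that] by (simp add: \<tau>_def)
  qed
  finally show ?thesis unfolding \<tau>_def .
qed

lemma Gamma_wick_level:
  assumes F: "\<And>\<phi> \<psi>. continuous_on UNIV \<phi> \<Longrightarrow> continuous_on UNIV \<psi> \<Longrightarrow> F \<phi> \<psi> = wick_level n X Y P a r \<phi> \<psi>"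
    and "continuous_on UNIV \<phi>" "continuous_on UNIV \<psi>"
  shows "Gamma D F \<phi> \<psi> = wick_level n X Y P (of_nat (Suc r) * a) (Suc r) \<phi> \<psi>"
proof -
  have "Gamma D F \<phi> \<psi> = (LINT x|config_measure (X \<union> Y). G (X \<union> Y) x *
      mixed_kernel X Y (level n (edges (X \<union> Y)) (cross X Y) r)
     (\<lambda>m x. a * wick_coeff n (X \<union> Y) (edges (X \<union> Y)) (weight P x) m) (\<lambda>m i. n - degr (edges (X \<union> Y)) m i)
     \<phi> \<psi> (\<lambda>(x, y). D (x - y)) x)"
    by (rule Gamma_polynomial_functional[OF finX finY _ assms(2,3) F[unfolded wick_level_def] cont_D])
      (auto intro!: tame_mult tame_const tame_wick_coeff cont_P)
  also have "\<dots> = of_nat (Suc r) * wick_level n X Y P a (Suc r) \<phi> \<psi>"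
    unfolding mixed_kernel_level wick_level_def polynomial_functional_def mult.left_commute[of "G _ _"]
    by (rule integral_mult_right_zero)
  finally show ?thesis by (simp only: wick_level_mult)
qed

lemma Gamma_funpow:
  assumes F: "\<And>\<phi> \<psi>. continuous_on UNIV \<phi> \<Longrightarrow> continuous_on UNIV \<psi> \<Longrightarrow> F \<phi> \<psi> = wick_level n X Y P a 0 \<phi> \<psi>"
    and "continuous_on UNIV \<phi>" "continuous_on UNIV \<psi>"
  shows "(Gamma D ^^ r) F \<phi> \<psi> = wick_level n X Y P (fact r * a) r \<phi> \<psi>"
  using assms(2,3)
proof (induction r arbitrary: \<phi> \<psi>)
  case 0
  then show ?case using F by simp
next
  case (Suc r)
  have "Gamma D ((Gamma D ^^ r) F) \<phi> \<psi> = wick_level n X Y P (of_nat (Suc r) * (fact r * a)) (Suc r) \<phi> \<psi>"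
    using Suc.IH Suc.prems by (rule Gamma_wick_level)
  then show ?case by (simp only: funpow.simps comp_def fact_Suc mult.assoc)
qed

text \<open>The r! from iterating \<open>Gamma\<close> cancels against the exponential series, so
  every contraction occurs once. Summing over the orders and setting both fields equal removes the
  distinction between internal and cross lines.\<close>

lemma exp_Gamma_wick:
  assumes F: "\<And>\<phi> \<psi>. continuous_on UNIV \<phi> \<Longrightarrow> continuous_on UNIV \<psi> \<Longrightarrow> F \<phi> \<psi> = wick_level n X Y P a 0 \<phi> \<psi>"
    and \<phi>: "continuous_on UNIV \<phi>"
  shows "exp_Gamma D F \<phi> \<phi> = a * wick_functional n (X \<union> Y) P \<phi>"
proof -
  let ?V = "X \<union> Y"
  let ?E = "edges ?V" and ?C = "cross X Y"
  let ?R = "n * card ?C"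
  have finV: "finite ?V" and finE: "finite ?E" using finX finY finite_edges by auto
  have C: "?C \<subseteq> ?E" by (auto simp: edges_Un)
  let ?\<tau> = "\<lambda>x m. wick_coeff n ?V ?E (weight P x) m *
      (\<Prod>i\<in>X. complex_of_real (\<phi> (x i)) ^ (n - degr ?E m i)) *
      (\<Prod>j\<in>Y. complex_of_real (\<phi> (x j)) ^ (n - degr ?E m j))"
  have lev: "wick_level n X Y P 1 r \<phi> \<phi> = (LINT x|config_measure ?V. G ?V x * (\<Sum>m\<in>level n ?E ?C r. ?\<tau> x m))" for r
    by (simp add: wick_level_def polynomial_functional_def)
  have "(Gamma D ^^ r) F \<phi> \<phi> / fact r = a * wick_level n X Y P 1 r \<phi> \<phi>" for r
  proof -
    have "(Gamma D ^^ r) F \<phi> \<phi> = wick_level n X Y P (fact r * a * 1) r \<phi> \<phi>"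
      using F \<phi> \<phi> unfolding mult_1_right by (rule Gamma_funpow)
    then show ?thesis by (simp only: wick_level_mult mult.assoc) simp
  qed
  then have "exp_Gamma D F \<phi> \<phi> = (\<Sum>r. a * wick_level n X Y P 1 r \<phi> \<phi>)"
    by (simp only: exp_Gamma_def)
  also have "\<dots> = (\<Sum>r\<le>?R. a * wick_level n X Y P 1 r \<phi> \<phi>)"
    by (rule suminf_finite) (auto simp: lev level_empty[OF C])
  also have "\<dots> = a * (\<Sum>r\<le>?R. wick_level n X Y P 1 r \<phi> \<phi>)"
    by (simp only: sum_distrib_left)
  also have "(\<Sum>r\<le>?R. wick_level n X Y P 1 r \<phi> \<phi>) =
      (LINT x|config_measure ?V. (\<Sum>r\<le>?R. G ?V x * (\<Sum>m\<in>level n ?E ?C r. ?\<tau> x m)))"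
    unfolding lev
    by (intro Bochner_Integration.integral_sum[symmetric] integrable_G_tame finV tame_sum tame_mult
        tame_wick_coeff cont_P tame_field_prod \<phi>) auto
  also have "\<dots> = wick_functional n ?V P \<phi>"
  proof -
    have "wick n ?V (weight P x) (\<lambda>i. complex_of_real (\<phi> (x i))) = (\<Sum>r\<le>?R. \<Sum>m\<in>level n ?E ?C r. ?\<tau> x m)" for x
      unfolding wick_def sum_mults_eq_sum_level[OF finE C]
      by (simp only: prod.union_disjoint[OF finX finY XY] mult.assoc)
    then show ?thesis unfolding wick_functional_def by (simp only: sum_distrib_left)
  qed
  finally show ?thesis .
qed

lemma wick_functional_mult:
  assumes \<phi>: "continuous_on UNIV \<phi>" and \<psi>: "continuous_on UNIV \<psi>"
  shows "wick_functional n X P \<phi> * wick_functional n Y P \<psi> = wick_level n X Y P 1 0 \<phi> \<psi>"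
proof -
  let ?V = "X \<union> Y"
  let ?E = "edges ?V" and ?C = "cross X Y"
  have finV: "finite ?V" using finX finY by auto
  let ?f = "\<lambda>x. G ?V x * (\<Sum>m\<in>level n ?E ?C 0. wick_coeff n ?V ?E (weight P x) m *
      (\<Prod>i\<in>X. complex_of_real (\<phi> (x i)) ^ (n - degr ?E m i)) *
      (\<Prod>j\<in>Y. complex_of_real (\<psi> (x j)) ^ (n - degr ?E m j)))"
  have int: "integrable (config_measure ?V) ?f"
    by (intro integrable_G_tame finV tame_sum tame_mult tame_wick_coeff cont_P tame_field_prod \<phi> \<psi>) auto
  have f: "?f (merge X Y (x, y)) = (G X x * wick n X (weight P x) (\<lambda>i. complex_of_real (\<phi> (x i)))) *
      (G Y y * wick n Y (weight P y) (\<lambda>i. complex_of_real (\<psi> (y i))))" for x y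
  proof -
    let ?z = "merge X Y (x, y)"
    \<comment> \<open>\<open>wick_mult\<close> has one family of variables, so the two fields are
      combined into one by choosing the field according to the vertex.\<close>
    let ?t = "\<lambda>i. complex_of_real (if i \<in> X then \<phi> (?z i) else \<psi> (?z i))"
    have zX: "?z i = x i" if "i \<in> X" for i using that by (simp add: merge_def)
    have zY: "?z i = y i" "i \<notin> X" if "i \<in> Y" for i using that XY by (auto simp: merge_def)
    have tX: "(\<Prod>i\<in>X. complex_of_real (\<phi> (?z i)) ^ d i) = (\<Prod>i\<in>X. ?t i ^ d i)" for d
      by (intro prod.cong) auto
    have tY: "(\<Prod>i\<in>Y. complex_of_real (\<psi> (?z i)) ^ d i) = (\<Prod>i\<in>Y. ?t i ^ d i)" for d
      using zY by (intro prod.cong) auto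
    have "?f ?z = G ?V ?z * (wick n X (weight P ?z) ?t * wick n Y (weight P ?z) ?t)"
      unfolding wick_mult[OF finX finY XY] tX tY prod.union_disjoint[OF finX finY XY] mult.assoc ..
    moreover have "wick n X (weight P ?z) ?t = wick n X (weight P x) (\<lambda>i. complex_of_real (\<phi> (x i)))"
      by (rule wick_cong) (auto simp: edges_def zX)
    moreover have "wick n Y (weight P ?z) ?t = wick n Y (weight P y) (\<lambda>i. complex_of_real (\<psi> (y i)))"
      by (rule wick_cong) (auto simp: edges_def zY)
    moreover have "G ?V ?z = G X x * G Y y"
      unfolding G_def prod.union_disjoint[OF finX finY XY]
      by (intro arg_cong2[where f = "(*)"] prod.cong) (auto simp: zX zY)
    ultimately show ?thesis by (simp only:) (simp only: mult_ac)
  qed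
  have "wick_level n X Y P 1 0 \<phi> \<psi> = (LINT x|config_measure ?V. ?f x)"
    by (simp add: wick_level_def polynomial_functional_def)
  also have "\<dots> = (LINT x|config_measure X. LINT y|config_measure Y. ?f (merge X Y (x, y)))"
    by (rule spacetime_prod.product_integral_fold[OF XY finX finY int])
  also have "\<dots> = wick_functional n X P \<phi> * wick_functional n Y P \<psi>"
    unfolding f wick_functional_def by (simp only: integral_mult_right_zero integral_mult_left_zero)
  finally show ?thesis by simp
qed

text \<open>Wick's theorem in a form that covers both products: \<open>D\<close> is
  \<open>Delta_F\<close> for powers and \<open>Delta_plus\<close> for the star product.\<close>

lemma product_wick_functional:
  assumes A: "\<And>\<phi>. continuous_on UNIV \<phi> \<Longrightarrow> A \<phi> = a * wick_functional n X P \<phi>"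
    and B: "\<And>\<phi>. continuous_on UNIV \<phi> \<Longrightarrow> B \<phi> = b * wick_functional n Y P \<phi>"
    and \<phi>: "continuous_on UNIV \<phi>"
  shows "diag (exp_Gamma D (tensor A B)) \<phi> = a * b * wick_functional n (X \<union> Y) P \<phi>"
  unfolding diag_def
proof (rule exp_Gamma_wick[OF _ \<phi>])
  fix \<phi> \<psi> :: "spacetime \<Rightarrow> real" assume c: "continuous_on UNIV \<phi>" "continuous_on UNIV \<psi>"
  have "tensor A B \<phi> \<psi> = a * b * (wick_functional n X P \<phi> * wick_functional n Y P \<psi>)"
    using A[OF c(1)] B[OF c(2)] by (simp add: tensor_def)
  then show "tensor A B \<phi> \<psi> = wick_level n X Y P (a * b) 0 \<phi> \<psi>"
    unfolding wick_functional_mult[OF c] using wick_level_mult[of n X Y P "a * b" 1] by simp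
qed

end

section \<open>Cancellation\<close>

text \<open>Toggling membership of \<open>z\<close> is an involution that reverses the sign of each
  term, so the sum equals its own negative.\<close>

lemma sum_Pow_alternating:
  fixes h :: "nat set \<Rightarrow> complex"
  assumes S: "finite S" and z: "z \<in> S"
    and h: "\<And>X. X \<subseteq> S \<Longrightarrow> z \<notin> X \<Longrightarrow> h (insert z X) = h X"
  shows "(\<Sum>X\<in>Pow S. (- 1) ^ card X * h X) = 0"
proof -
  let ?f = "\<lambda>X. (- 1) ^ card X * h X"
  define T where "T X = (if z \<in> X then X - {z} else insert z X)" for X
  have neg: "?f (T X) = - ?f X" if X: "X \<subseteq> S" for X
  proof (cases "z \<in> X")
    case True
    have fin: "finite X" using X S by (rule finite_subset)
    have "h (insert z (X - {z})) = h (X - {z})" using X by (intro h) auto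
    moreover have "insert z (X - {z}) = X" using True by auto
    ultimately have hX: "h X = h (X - {z})" by simp
    have "(- 1 :: complex) ^ card X = - ((- 1) ^ card (X - {z}))"
      unfolding card.remove[OF fin True] power_Suc by simp
    then show ?thesis unfolding T_def if_P[OF True] hX by simp
  next
    case False
    have fin: "finite X" using X S by (rule finite_subset)
    then show ?thesis using False X by (simp add: T_def h)
  qed
  have TT: "T (T X) = X" for X by (auto simp: T_def)
  have TS: "T X \<subseteq> S" if "X \<subseteq> S" for X using that z by (auto simp: T_def)
  have "(\<Sum>X\<in>Pow S. ?f X) = (\<Sum>X\<in>Pow S. ?f (T X))"
    by (rule sum.reindex_bij_witness[where i = T and j = T]) (use TT TS in auto)
  also have "\<dots> = - (\<Sum>X\<in>Pow S. ?f X)"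
    unfolding sum_negf[symmetric] by (intro sum.cong refl neg) auto
  finally show ?thesis by simp
qed

text \<open>The propagators in a \<open>\<star>\<close>-product whose left factor has the vertices \<open>X\<close> with internal
  propagator \<open>L\<close>, and whose right factor has the remaining vertices with internal propagator \<open>R\<close>.\<close>

definition mixed_propagator ::
  "real \<Rightarrow> real \<Rightarrow> (spacetime \<Rightarrow> complex) \<Rightarrow> (spacetime \<Rightarrow> complex) \<Rightarrow> nat set \<Rightarrow> edge \<Rightarrow> spacetime \<Rightarrow> complex" where
  "mixed_propagator m lam L R X e z =
     (if fst e \<in> X then if snd e \<in> X then L z else Delta_plus m lam z
      else if snd e \<in> X then Delta_plus m lam (- z) else R z)"

lemma continuous_mixed_propagator:
  assumes pos: "m > 0" "lam > 0" and L: "continuous_on UNIV L" and R: "continuous_on UNIV R"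
  shows "continuous_on UNIV (mixed_propagator m lam L R X e)"
proof -
  have D: "continuous_on UNIV (Delta_plus m lam)" by (rule continuous_Delta_plus[OF pos])
  then have "continuous_on UNIV (\<lambda>z. Delta_plus m lam (- z))"
    by (rule continuous_on_compose2) (auto intro: continuous_intros)
  with D L R show ?thesis
    unfolding mixed_propagator_def[abs_def] by (cases "fst e \<in> X"; cases "snd e \<in> X") simp_all
qed

context source
begin

lemma wick_functional_empty: "wick_functional n {} P \<phi> = 1"
proof -
  have "mults n {} = {\<lambda>_. 0}" by (auto simp: mults_def)
  then have "wick n {} w t = 1" for w t by (simp add: wick_def edges_def wick_coeff_def)
  then have "wick_functional n {} P \<phi> = (LINT x|config_measure {}. (\<Prod>i\<in>{}. (\<lambda>_ _. 1) i (x i)))"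
    by (simp add: wick_functional_def G_def)
  also have "\<dots> = 1" by (subst spacetime_prod.product_integral_prod) auto
  finally show ?thesis .
qed

lemma wick_functional_singleton:
  assumes "continuous_on UNIV \<phi>"
  shows "wick_functional n {b} P \<phi> = interaction g n \<phi>"
proof -
  have "edges {b} = {}" by (auto simp: edges_def)
  moreover have "mults n {} = {\<lambda>_. 0}" by (auto simp: mults_def)
  ultimately have "wick n {b} w t = t b ^ n" for w t
    by (simp add: wick_def wick_coeff_def degr_def falling_def)
  then have "wick_functional n {b} P \<phi> = (LINT x|config_measure {b}. complex_of_real (g (x b) * \<phi> (x b) ^ n))"
    by (simp add: wick_functional_def G_def)
  also have "\<dots> = (LINT z|lborel. complex_of_real (g z * \<phi> z ^ n))"
  proof (rule spacetime_prod.product_integral_singleton)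
    have "continuous_on UNIV (\<lambda>z. complex_of_real (g z * \<phi> z ^ n))"
      by (intro continuous_intros cont_g assms)
    then show "(\<lambda>z. complex_of_real (g z * \<phi> z ^ n)) \<in> borel_measurable lborel"
      using borel_measurable_continuous_onI by simp
  qed
  also have "\<dots> = interaction g n \<phi>"
    unfolding interaction_def by (rule integral_complex_of_real)
  finally show ?thesis .
qed

lemma wick_functional_cong:
  assumes "\<And>e. e \<in> edges V \<Longrightarrow> P e = P' e"
  shows "wick_functional n V P = wick_functional n V P'"
proof -
  have "wick n V (weight P x) t = wick n V (weight P' x) t" for x t
    using assms by (intro wick_cong) auto
  then show ?thesis by (intro ext) (simp add: wick_functional_def)
qed

text \<open>The source, the fields and the combinatorial factors are real; conjugation reaches only
  the propagators.\<close>

lemma cnj_wick_functional: "cnj (wick_functional n V P \<phi>) = wick_functional n V (\<lambda>e z. cnj (P e z)) \<phi>"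
proof -
  have "cnj (G V x * wick n V (weight P x) (\<lambda>i. complex_of_real (\<phi> (x i)))) =
      G V x * wick n V (weight (\<lambda>e z. cnj (P e z)) x) (\<lambda>i. complex_of_real (\<phi> (x i)))" for x
    by (simp add: G_def wick_def wick_coeff_def falling_def)
  then show ?thesis
    unfolding wick_functional_def Bochner_Integration.integral_cnj[symmetric] by simp
qed

text \<open>Stated for arbitrary vertex sets, since the left factor of a star product will use any
  subset of the vertices. Evenness of \<open>Delta_F\<close> makes the stored direction of a line
  immaterial.\<close>

lemma tpower_eq_wick_functional:
  assumes pos: "m > 0" "lam > 0" and "finite V" "continuous_on UNIV \<phi>"
  shows "tpower m lam (interaction g n) (card V) \<phi> = wick_functional n V (\<lambda>_. Delta_F m lam) \<phi>"
  using assms(3,4)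
proof (induction V arbitrary: \<phi> rule: finite_linorder_max_induct)
  case empty
  then show ?case by (simp add: wick_functional_empty)
next
  case (insert b A)
  interpret wick_product g K "{b}" A "\<lambda>_. Delta_F m lam" "Delta_F m lam" n
    by unfold_locales (use insert(1,2) continuous_Delta_F[OF pos] in \<open>auto simp: Delta_F_uminus\<close>)
  have "b \<notin> A" using insert(2) by auto
  then have "tpower m lam (interaction g n) (card (insert b A)) \<phi> =
      tprod m lam (interaction g n) (tpower m lam (interaction g n) (card A)) \<phi>"
    using insert(1) by simp
  also have "\<dots> = 1 * 1 * wick_functional n ({b} \<union> A) (\<lambda>_. Delta_F m lam) \<phi>"
    unfolding tprod_def
    by (rule product_wick_functional) (use insert in \<open>auto simp: wick_functional_singleton\<close>)
  finally show ?case by simp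
qed

lemma star_eq_wick_functional:
  assumes pos: "m > 0" "lam > 0" and fin: "finite X" "finite Y" and XY: "X \<inter> Y = {}"
    and L: "continuous_on UNIV L" and R: "continuous_on UNIV R"
    and A: "\<And>\<phi>. continuous_on UNIV \<phi> \<Longrightarrow> A \<phi> = a * wick_functional n X (\<lambda>_. L) \<phi>"
    and B: "\<And>\<phi>. continuous_on UNIV \<phi> \<Longrightarrow> B \<phi> = b * wick_functional n Y (\<lambda>_. R) \<phi>"
    and \<phi>: "continuous_on UNIV \<phi>"
  shows "star m lam A B \<phi> = a * b * wick_functional n (X \<union> Y) (mixed_propagator m lam L R X) \<phi>"
proof -
  note cont = continuous_mixed_propagator[OF pos L R]
  have D: "continuous_on UNIV (Delta_plus m lam)" by (rule continuous_Delta_plus[OF pos])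
  interpret wick_product g K X Y "mixed_propagator m lam L R X" "Delta_plus m lam" n
    by unfold_locales (use fin XY cont D in \<open>auto simp: mixed_propagator_def\<close>)
  have WX: "wick_functional n X (mixed_propagator m lam L R X) = wick_functional n X (\<lambda>_. L)"
    by (rule wick_functional_cong) (auto simp: edges_def mixed_propagator_def fun_eq_iff)
  have WY: "wick_functional n Y (mixed_propagator m lam L R X) = wick_functional n Y (\<lambda>_. R)"
    using XY by (intro wick_functional_cong) (auto simp: edges_def mixed_propagator_def fun_eq_iff)
  show ?thesis unfolding star_def
    by (rule product_wick_functional) (use A B \<phi> in \<open>auto simp: WX WY\<close>)
qed

text \<open>By permutation symmetry the term of order \<open>(j, k - j)\<close> is an average over the vertex sets
  \<open>X \<subseteq> {..<k}\<close> with \<open>j\<close> elements, which turns the sum over \<open>j\<close> into an alternating sum over all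
  \<open>X\<close>. It cancels already in the integrand.\<close>

lemma sum_star_eq_0:
  assumes pos: "m > 0" "lam > 0" and k: "k > 0"
    and L: "continuous_on UNIV L" and R: "continuous_on UNIV R"
    and A: "\<And>V \<phi>. finite V \<Longrightarrow> continuous_on UNIV \<phi> \<Longrightarrow> A (card V) \<phi> = \<alpha> (card V) * wick_functional n V (\<lambda>_. L) \<phi>"
    and B: "\<And>V \<phi>. finite V \<Longrightarrow> continuous_on UNIV \<phi> \<Longrightarrow> B (card V) \<phi> = \<beta> (card V) * wick_functional n V (\<lambda>_. R) \<phi>"
    and \<alpha>\<beta>: "\<And>j. j \<le> k \<Longrightarrow> \<alpha> j * \<beta> (k - j) = (- 1) ^ j * \<gamma> / (fact j * fact (k - j))"
    and toggle: "\<And>x. \<exists>z<k. \<forall>X. z \<notin> X \<longrightarrow> (\<forall>e\<in>edges {..<k}.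
        weight (mixed_propagator m lam L R (insert z X)) x e = weight (mixed_propagator m lam L R X) x e)"
    and \<phi>: "continuous_on UNIV \<phi>"
  shows "(\<Sum>j\<le>k. star m lam (A j) (B (k - j)) \<phi>) = 0"
proof -
  let ?S = "{..<k}"
  let ?P = "mixed_propagator m lam L R"
  let ?W = "\<lambda>X. wick_functional n ?S (?P X) \<phi>"
  note cont = continuous_mixed_propagator[OF pos L R]
  have star: "star m lam (A j) (B (k - j)) \<phi> = \<alpha> j * \<beta> (k - j) * ?W X"
    if X: "X \<subseteq> ?S" "card X = j" for X j
  proof -
    have fin: "finite X" using X(1) finite_subset by blast
    have cardY: "card (?S - X) = k - j" using card_Diff_subset[OF fin X(1)] X(2) by simp
    have "star m lam (A (card X)) (B (card (?S - X))) \<phi> =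
        \<alpha> (card X) * \<beta> (card (?S - X)) * wick_functional n (X \<union> (?S - X)) (?P X) \<phi>"
      by (rule star_eq_wick_functional[OF pos fin _ _ L R A B \<phi>]) (use fin in auto)
    moreover have "X \<union> (?S - X) = ?S" using X(1) by auto
    ultimately show ?thesis using X(2) cardY by simp
  qed
  have "star m lam (A j) (B (k - j)) \<phi> = \<gamma> / fact k * (\<Sum>X\<in>{X \<in> Pow ?S. card X = j}. (- 1) ^ card X * ?W X)"
    if j: "j \<le> k" for j
  proof -
    let ?s = "star m lam (A j) (B (k - j)) \<phi>"
    have cards: "card {X \<in> Pow ?S. card X = j} = k choose j"
      using n_subsets[of ?S j] by simp
    have choose: "of_nat (k choose j) = (fact k / (fact j * fact (k - j)) :: complex)"
      by (rule binomial_fact[OF j])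
    have "?s * of_nat (k choose j) = (\<Sum>X\<in>{X \<in> Pow ?S. card X = j}. ?s)"
      using cards by simp
    also have "\<dots> = (\<Sum>X\<in>{X \<in> Pow ?S. card X = j}. \<gamma> / (fact j * fact (k - j)) * ((- 1) ^ card X * ?W X))"
    proof (rule sum.cong[OF refl])
      fix X assume "X \<in> {X \<in> Pow ?S. card X = j}"
      then have "X \<subseteq> ?S" "card X = j" by auto
      from star[OF this] this(2) show "?s = \<gamma> / (fact j * fact (k - j)) * ((- 1) ^ card X * ?W X)"
        by (simp add: \<alpha>\<beta>[OF j])
    qed
    also have "\<dots> = \<gamma> / (fact j * fact (k - j)) * (\<Sum>X\<in>{X \<in> Pow ?S. card X = j}. (- 1) ^ card X * ?W X)"
      by (rule sum_distrib_left[symmetric])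
    finally show ?thesis unfolding choose by (simp add: field_simps)
  qed
  then have "(\<Sum>j\<le>k. star m lam (A j) (B (k - j)) \<phi>) =
      (\<Sum>j\<le>k. \<gamma> / fact k * (\<Sum>X\<in>{X \<in> Pow ?S. card X = j}. (- 1) ^ card X * ?W X))"
    by (intro sum.cong) auto
  also have "\<dots> = \<gamma> / fact k * (\<Sum>X\<in>Pow ?S. (- 1) ^ card X * ?W X)"
  proof -
    have "card X \<le> k" if "X \<in> Pow ?S" for X
      using card_mono[of ?S X] that by simp
    then have "(\<Sum>j\<le>k. \<Sum>X\<in>{X \<in> Pow ?S. card X = j}. (- 1) ^ card X * ?W X) = (\<Sum>X\<in>Pow ?S. (- 1) ^ card X * ?W X)"
      by (intro sum.group) auto
    then show ?thesis by (simp only: sum_distrib_left[symmetric])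
  qed
  also have "(\<Sum>X\<in>Pow ?S. (- 1) ^ card X * ?W X) = (LINT x|config_measure ?S. (\<Sum>X\<in>Pow ?S.
      (- 1) ^ card X * (G ?S x * wick n ?S (weight (?P X) x) (\<lambda>i. complex_of_real (\<phi> (x i))))))"
    unfolding wick_functional_def
    by (subst Bochner_Integration.integral_sum)
      (auto intro!: integrable_mult_right integrable_G_tame tame_wick cont \<phi>)
  also have "\<dots> = 0"
  proof -
    \<comment> \<open>The vertex to be moved depends on the positions x, so the involution is chosen
      anew at every x.\<close>
    have "(\<Sum>X\<in>Pow ?S. (- 1) ^ card X * (G ?S x * wick n ?S (weight (?P X) x) t)) = 0" for x t
    proof -
      obtain z where z: "z < k" "\<And>X e. z \<notin> X \<Longrightarrow> e \<in> edges ?S \<Longrightarrow>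
          weight (?P (insert z X)) x e = weight (?P X) x e"
        using toggle[of x] by blast
      have "wick n ?S (weight (?P (insert z X)) x) t = wick n ?S (weight (?P X) x) t" if "z \<notin> X" for X
        by (rule wick_cong[OF z(2)[OF that] refl])
      then show ?thesis using z(1) by (intro sum_Pow_alternating[of _ z]) auto
    qed
    then show ?thesis by simp
  qed
  finally show ?thesis by simp
qed

end

text \<open>Only lines from z to some y change. If y is in \<open>X\<close>, the time-ordered
  propagator and the cross propagator are both \<Delta>+(y - z), as y is not earlier. Otherwise both
  are \<Delta>+(z - y), the conjugate of the former.\<close>

lemma mixed_propagator_toggle_earliest:
  assumes z: "z < k" "\<And>i. i < k \<Longrightarrow> fst (x z :: spacetime) \<le> fst (x i)" and "z \<notin> X" "e \<in> edges {..<k}"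
  shows "weight (mixed_propagator m lam (Delta_F m lam) (\<lambda>z. cnj (Delta_F m lam z)) (insert z X)) x e =
     weight (mixed_propagator m lam (Delta_F m lam) (\<lambda>z. cnj (Delta_F m lam z)) X) x e"
proof -
  obtain i j where e: "e = (i, j)" "i < j" "i < k" "j < k" using assms(4) by (auto simp: edges_def)
  have "fst (x z - x j) \<le> 0" "0 \<le> fst (x i - x z)" using z(2) e by auto
  then show ?thesis
    using assms(3) e by (auto simp: mixed_propagator_def Delta_F_nonneg Delta_F_nonpos cnj_Delta_plus simp del: fst_diff minus_diff_eq)
qed

text \<open>With conjugated propagators now on the left, the line is \<Delta>+(y - z) for y in
  \<open>X\<close> and \<Delta>+(z - y) otherwise, on either side, as y is not later than z.\<close>

lemma mixed_propagator_toggle_latest: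
  assumes z: "z < k" "\<And>i. i < k \<Longrightarrow> fst (x i) \<le> fst (x z :: spacetime)" and "z \<notin> X" "e \<in> edges {..<k}"
  shows "weight (mixed_propagator m lam (\<lambda>z. cnj (Delta_F m lam z)) (Delta_F m lam) (insert z X)) x e =
     weight (mixed_propagator m lam (\<lambda>z. cnj (Delta_F m lam z)) (Delta_F m lam) X) x e"
proof -
  obtain i j where e: "e = (i, j)" "i < j" "i < k" "j < k" using assms(4) by (auto simp: edges_def)
  have "0 \<le> fst (x z - x j)" "fst (x i - x z) \<le> 0" using z(2) e by auto
  then show ?thesis
    using assms(3) e by (auto simp: mixed_propagator_def Delta_F_nonneg Delta_F_nonpos cnj_Delta_plus simp del: fst_diff minus_diff_eq)
qed

section \<open>Constants as elements of the algebra\<close>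

lemma zero_in_functionals: "(\<And>\<phi>. \<phi> \<in> configs \<Longrightarrow> A \<phi> = 0) \<Longrightarrow> A \<in> functionals"
  unfolding functionals_def by (auto intro!: exI[of _ 0])

text \<open>Every generator involves at least one compactly supported integration, so the unit is
  realised by a kernel of integral one and field exponent 0. The kernel is the tent function
  \<open>b\<close> divided by its integral.\<close>

lemma one_in_functionals:
  assumes "\<And>\<phi>. \<phi> \<in> configs \<Longrightarrow> A \<phi> = 1"
  shows "A \<in> functionals"
proof -
  define b where "b z = max 0 (1 - norm z)" for z :: spacetime
  have bc: "continuous_on UNIV b" unfolding b_def by (intro continuous_intros)
  have b0: "b z \<ge> 0" for z by (simp add: b_def)
  have bK: "z \<in> cball 0 1" if "b z \<noteq> 0" for z using that by (auto simp: b_def max_def split: if_splits)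
  have "integrable lborel (\<lambda>x. indicator (cball 0 1) x *\<^sub>R b x)"
    using bc by (intro borel_integrable_compact) (auto elim: continuous_on_subset)
  moreover have "(\<lambda>x. indicator (cball 0 1) x *\<^sub>R b x) = b"
    using bK by (fastforce simp: indicator_def fun_eq_iff)
  ultimately have bint: "integrable lborel b" by simp
  define J where "J = (LINT z|lborel. b z)"
  \<comment> \<open>The tent is at least 1/2 on the ball of radius 1/2, so the normalising integral
    is positive.\<close>
  have "0 < measure lborel (cball (0::spacetime) (1/2)) * (1/2)"
    using content_cball_pos[of "1/2" "0::spacetime"] by simp
  also have "\<dots> = (LINT z|lborel. indicator (cball (0::spacetime) (1/2)) z *\<^sub>R (1/2))"
    using emeasure_lborel_cball_finite[of "0::spacetime" "1/2"] by simp
  also have "\<dots> \<le> J" unfolding J_def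
  proof (rule integral_mono[OF _ bint])
    show "integrable lborel (\<lambda>z::spacetime. indicator (cball 0 (1/2)) z *\<^sub>R (1/2::real))"
      using emeasure_lborel_cball_finite[of "0::spacetime" "1/2"] by (intro integrable_scaleR_left) simp
    show "indicator (cball 0 (1/2)) z *\<^sub>R (1/2) \<le> b z" for z
      by (auto simp: indicator_def b_def)
  qed
  finally have J: "J > 0" .
  define f where "f x = complex_of_real (b (x 0) / J)" for x :: "nat \<Rightarrow> spacetime"
  have "cc_kernel 1 f"
    unfolding cc_kernel_def
  proof (intro conjI exI[of _ "cball 0 1"])
    have "continuous_on UNIV f" unfolding f_def
      using J by (intro continuous_intros continuous_on_compose2[OF bc] continuous_on_product_coordinates) auto
    then show "continuous_on ({..<1} \<rightarrow>\<^sub>E UNIV) f" by (rule continuous_on_subset) simp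
    show "\<forall>x\<in>{..<1} \<rightarrow>\<^sub>E UNIV. f x \<noteq> 0 \<longrightarrow> (\<forall>i<1. x i \<in> cball 0 1)"
      using bK by (auto simp: f_def simp del: mem_cball)
  qed simp
  moreover have "monomial_functional 1 (\<lambda>_. 0) f \<phi> = 1" for \<phi>
  proof -
    have "{..<1::nat} = {0}" by auto
    then have "monomial_functional 1 (\<lambda>_. 0) f \<phi> = (LINT x|Pi\<^sub>M {0::nat} (\<lambda>_. lborel). complex_of_real (b (x 0) / J))"
      by (simp add: monomial_functional_def f_def)
    also have "\<dots> = (LINT z|lborel. complex_of_real (b z / J))"
    proof (rule spacetime_prod.product_integral_singleton)
      have "continuous_on UNIV (\<lambda>z. complex_of_real (b z / J))"
        using J by (intro continuous_intros bc) auto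
      then show "(\<lambda>z. complex_of_real (b z / J)) \<in> borel_measurable lborel"
        using borel_measurable_continuous_onI by simp
    qed
    also have "\<dots> = complex_of_real (LINT z|lborel. b z / J)" by (rule integral_complex_of_real)
    also have "(LINT z|lborel. b z / J) = J / J" by (simp add: J_def)
    finally show ?thesis using J by simp
  qed
  ultimately show ?thesis
    unfolding functionals_def using assms
    by (intro CollectI exI[of _ 1] exI[of _ "\<lambda>_. 1"] exI[of _ "\<lambda>_ _. 0"] exI[of _ "\<lambda>_. f"]) auto
qed

text \<open>Membership in \<open>functionals\<close> depends only on values on
  \<open>configs\<close>, so the values 0 and 1 of the coefficients also settle that both series lie
  in the algebra.\<close>

lemma series_eq_oneI:
  assumes "\<And>k \<phi>. \<phi> \<in> configs \<Longrightarrow> X k \<phi> = (if k = 0 then 1 else 0)"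
  shows "series_eq X series_one"
proof -
  have "Z k \<in> functionals" if "\<And>k \<phi>. \<phi> \<in> configs \<Longrightarrow> Z k \<phi> = (if k = 0 then 1 else 0)" for Z :: fseries and k
    using that by (cases "k = 0") (auto intro: one_in_functionals zero_in_functionals)
  from this[of X] this[of series_one] show ?thesis
    using assms by (auto simp: series_eq_def formal_functionals_def series_one_def)
qed

theorem proposition4p4:
  fixes m lam :: real and n :: nat and g :: "spacetime \<Rightarrow> real"
  assumes "m > 0" and "lam > 0" and "g \<in> test_functions"
  shows
        "series_eq
           (series_star m lam (S_matrix m lam (interaction g n))
              (series_adj (S_matrix m lam (interaction g n))))
           series_one \<and>
         series_eq
           (series_star m lam (series_adj (S_matrix m lam (interaction g n)))
              (S_matrix m lam (interaction g n)))
           series_one"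
proof -
  \<comment> \<open>Inserting 0 keeps the compact set nonempty when g vanishes identically.\<close>
  interpret source g "insert 0 (closure {x. g x \<noteq> 0})"
  proof
    show "continuous_on UNIV g" using assms(3) smooth_imp_continuous by (auto simp: test_functions_def)
    show "compact (insert 0 (closure {x. g x \<noteq> 0}))" using assms(3) by (auto simp: test_functions_def)
    show "z \<in> insert 0 (closure {x. g x \<noteq> 0})" if "g z \<noteq> 0" for z
      using that closure_subset[of "{x. g x \<noteq> 0}"] by auto
  qed simp
  note pos = assms(1,2)
  let ?S = "S_matrix m lam (interaction g n)"
  let ?F = "Delta_F m lam" and ?F' = "\<lambda>z. cnj (Delta_F m lam z)"
  have F: "continuous_on UNIV ?F" and F': "continuous_on UNIV ?F'"
    using continuous_Delta_F[OF pos] by (auto intro: continuous_intros)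
  have S: "?S (card V) \<phi> = (- \<i>) ^ card V / fact (card V) * wick_functional n V (\<lambda>_. ?F) \<phi>"
    if "finite V" "continuous_on UNIV \<phi>" for V \<phi>
    using tpower_eq_wick_functional[OF pos that] by (simp add: S_matrix_def)
  have S': "series_adj ?S (card V) \<phi> = \<i> ^ card V / fact (card V) * wick_functional n V (\<lambda>_. ?F') \<phi>"
    if "finite V" "continuous_on UNIV \<phi>" for V \<phi>
    using S[OF that] by (simp add: series_adj_def adj_def cnj_wick_functional)
  have ord0: "star m lam (A 0) (B 0) \<phi> = 1"
    if A: "\<And>\<phi>. continuous_on UNIV \<phi> \<Longrightarrow> A 0 \<phi> = wick_functional n {} (\<lambda>_. L) \<phi>" and L: "continuous_on UNIV L"
      and B: "\<And>\<phi>. continuous_on UNIV \<phi> \<Longrightarrow> B 0 \<phi> = wick_functional n {} (\<lambda>_. R) \<phi>" and R: "continuous_on UNIV R"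
      and \<phi>: "continuous_on UNIV \<phi>" for A B :: fseries and L R \<phi>
    using star_eq_wick_functional[OF pos, of "{}" "{}" L R "A 0" 1 n "B 0" 1 \<phi>] that
    by (simp add: wick_functional_empty)
  \<comment> \<open>In either product the sign is extracted from the left factor. What remains is a
    power of \<i> or of -\<i> with exponent k, which does not depend on j and serves as
    \<open>\<gamma>\<close>.\<close>
  have i_pow: "(- \<i>) ^ j = (- 1) ^ j * \<i> ^ j" "\<i> ^ j = (- 1) ^ j * (- \<i>) ^ j" for j
    by (simp_all flip: power_mult_distrib)
  have coeff1: "(- \<i>) ^ j / fact j * (\<i> ^ (k - j) / fact (k - j)) = (- 1) ^ j * \<i> ^ k / (fact j * fact (k - j))"
    if "j \<le> k" for j k
    using that unfolding i_pow(1)[of j] by (simp add: power_add[symmetric] mult.assoc)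
  have coeff2: "\<i> ^ j / fact j * ((- \<i>) ^ (k - j) / fact (k - j)) = (- 1) ^ j * (- \<i>) ^ k / (fact j * fact (k - j))"
    if "j \<le> k" for j k
  proof -
    have "(- \<i>) ^ j * (- \<i>) ^ (k - j) = (- \<i>) ^ k" using that by (simp flip: power_add)
    then show ?thesis unfolding i_pow(2)[of j] by (metis mult.assoc times_divide_times_eq)
  qed
  \<comment> \<open>Applied to the times it yields a latest vertex, to the negated times an earliest
    one.\<close>
  have latest: "\<exists>z<k. \<forall>i<k. t i \<le> t z" if "k \<noteq> 0" for t :: "nat \<Rightarrow> real" and k
  proof -
    have "Max (t ` {..<k}) \<in> t ` {..<k}" using that by (intro Max_in) auto
    then obtain z where z: "z < k" "t z = Max (t ` {..<k})" by auto
    have "t i \<le> t z" if "i < k" for i unfolding z(2) using that by (intro Max_ge) auto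
    with z(1) show ?thesis by blast
  qed
  show ?thesis
  proof (intro conjI series_eq_oneI)
    fix k and \<phi> :: "spacetime \<Rightarrow> real" assume "\<phi> \<in> configs"
    then have \<phi>: "continuous_on UNIV \<phi>" by (rule configs_continuous)
    show "series_star m lam ?S (series_adj ?S) k \<phi> = (if k = 0 then 1 else 0)"
    proof (cases "k = 0")
      case True
      then show ?thesis
        using ord0[of ?S ?F "series_adj ?S" ?F'] S[of "{}"] S'[of "{}"] F F' \<phi> by (simp add: series_star_def)
    next
      case False
      have "\<exists>z<k. \<forall>X. z \<notin> X \<longrightarrow> (\<forall>e\<in>edges {..<k}. weight (mixed_propagator m lam ?F ?F' (insert z X)) x e =
          weight (mixed_propagator m lam ?F ?F' X) x e)" for x
      proof -
        obtain z where "z < k" "\<And>i. i < k \<Longrightarrow> fst (x z) \<le> fst (x i)"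
          using latest[OF False, of "\<lambda>i. - fst (x i)"] by auto
        then show ?thesis using mixed_propagator_toggle_earliest[of z k x] by blast
      qed
      from sum_star_eq_0[OF pos _ F F' S S' coeff1 this \<phi>] False show ?thesis
        by (simp add: series_star_def)
    qed
    show "series_star m lam (series_adj ?S) ?S k \<phi> = (if k = 0 then 1 else 0)"
    proof (cases "k = 0")
      case True
      then show ?thesis
        using ord0[of "series_adj ?S" ?F' ?S ?F] S[of "{}"] S'[of "{}"] F F' \<phi> by (simp add: series_star_def)
    next
      case False
      have "\<exists>z<k. \<forall>X. z \<notin> X \<longrightarrow> (\<forall>e\<in>edges {..<k}. weight (mixed_propagator m lam ?F' ?F (insert z X)) x e =
          weight (mixed_propagator m lam ?F' ?F X) x e)" for x
      proof -
        obtain z where "z < k" "\<And>i. i < k \<Longrightarrow> fst (x i) \<le> fst (x z)"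
          using latest[OF False, of "\<lambda>i. fst (x i)"] by auto
        then show ?thesis using mixed_propagator_toggle_latest[of z k x] by blast
      qed
      from sum_star_eq_0[OF pos _ F' F S' S coeff2 this \<phi>] False show ?thesis
        by (simp add: series_star_def)
    qed
  qed
qed

end
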